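(* Let $m,n,r$ be positive integers with $r<\min\{m,n\}$, let $f:\mathbb{R}^{m\times n}\to\mathbb{R}$ be differentiable with locally Lipschitz continuous gradient, and let $0<\underline{\alpha}\le\overline{\alpha}<\infty$, $\beta,c,\tau\in(0,1)$, $\kappa_1\in(0,\frac12]$, $\kappa_2\in(0,1]$, $\Delta,\varepsilon\in(0,\infty)$. Let $r_0\in\{1,\dots,r\}$ and $X_0\in\mathbb{R}^{m\times n}_{\le r_0}$ be such that $\{X\in\mathbb{R}^{m\times n}_{\le r}: f(X)\le f(X_0)\}$ is bounded. Let $((X_i)_{i=0}^{i_*},(r_i)_{i=0}^{i_*})$, $i_*\in\mathbb{N}\cup\{\infty\}$, be generated by the rank-increasing $\mathrm{ERFDR}$ algorithm with these parameters and input $(X_0,r_0)$. If $i_*<\infty$, then $X_{i_*}$ is B-stationary on $\mathbb{R}^{m\times n}_{\le r_{i_*}}$, i.e., $\mathrm{s}(X_{i_*};f,\mathbb{R}^{m\times n}_{\le r_{i_*}})=0$. Otherwise, letting $\underline{r}$ denote the limit of $(r_i)_{i\in\mathbb{N}}$: 1. each of the accumulation points of $(X_i)_{i\in\mathbb{N}}$, of which there exists at least one, is B-stationary on $\mathbb{R}^{m\times n}_{\le\underline{r}}$, i.e., is a zero of $\mathrm{s}(\cdot;f,\mathbb{R}^{m\times n}_{\le\underline{r}})$; 2. $\lim_{i\to\infty}\mathrm{s}(X_i;f,\mathbb{R}^{m\times n}_{\le\underline{r}})=0$; 3. all accumulation points of $(X_i)_{i\in\mathbb{N}}$ have the same image by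 $f$.
   Context: $\mathbb{R}^{m\times n}$ carries the Frobenius inner product $\langle X,Y\rangle=\operatorname{tr}(Y^\top X)$ and Frobenius norm $\|\cdot\|$. For an integer $q\ge 0$, $\mathbb{R}^{m\times n}_{\le q}=\{X:\operatorname{rank}X\le q\}$ and $\mathbb{R}^{m\times n}_{q}=\{X:\operatorname{rank}X=q\}$; $\sigma_1(X)\ge\dots\ge\sigma_{\min\{m,n\}}(X)\ge0$ are the singular values of $X$. Locally Lipschitz continuous gradient means: for every closed ball $\mathcal{B}\subsetneq\mathbb{R}^{m\times n}$, $\sup_{X,Y\in\mathcal{B},X\ne Y}\|\nabla f(X)-\nabla f(Y)\|/\|X-Y\|<\infty$. For nonempty $\mathcal{S}\subseteq\mathbb{R}^{m\times n}$, $P_{\mathcal{S}}(X)=\operatorname{argmin}_{Y\in\mathcal{S}}\|X-Y\|$ (a set). Tangent cone: for $X\in\mathcal{S}$, $T_{\mathcal{S}}(X)$ is the set of all $Z$ for which there are sequences $(X_i)$ in $\mathcal{S}$ converging to $X$ and $(t_i)$ in $(0,\infty)$ with $(X_i-X)/t_i\to Z$. It is a closed cone. All elements of the projection of a given point onto a closed cone have the same norm. For $X\in\mathbb{R}^{m\times n}_{\le q}$, $\mathrm{s}(X;f,\mathbb{R}^{m\times n}_{\le q})$ is the common norm of the elements of $P_{T_{\mathbb{R}^{m\times n}_{\le q}}(X)}(-\nabla f(X))$; it vanishes if and only if $X$ is B-stationary on $\mathbb{R}^{m\times n}_{\le q}$, i.e., $\langle\nabla f(X),Z\rangle\ge0$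 for all $Z\in T_{\mathbb{R}^{m\times n}_{\le q}}(X)$. The following is for a positive integer $q<\min\{m,n\}$. $\mathrm{ERFD}$ map with parameters $(f,q,\underline{\alpha},\overline{\alpha},\beta,c,\kappa_1,\kappa_2)$. Input $X\in\mathbb{R}^{m\times n}_{\le q}$. (1) Choose any $G\in\mathbb{R}^{m\times n}$ such that $\langle G,-\nabla f(X)\rangle\ge\max\{\kappa_1\,\mathrm{s}(X;f,\mathbb{R}^{m\times n}_{\le q})^2,\ \kappa_2\|G\|^2\}$ and $X+\alpha G\in\mathbb{R}^{m\times n}_{\le q}$ for all $\alpha\in[0,\overline{\alpha}]$. (2) Choose any $\alpha\in[\underline{\alpha},\overline{\alpha}]$. (3) While $f(X+\alpha G)>f(X)+c\,\alpha\langle\nabla f(X),G\rangle$, replace $\alpha$ by $\alpha\beta$. (4) Return $X+\alpha G$. The set of all possible outputs is $\mathrm{ERFD}(X;f,q,\underline{\alpha},\overline{\alpha},\beta,c,\kappa_1,\kappa_2)$. $\mathrm{ERFDR}$ map with the additional parameter $\Delta\in(0,\infty)$. Input $X\in\mathbb{R}^{m\times n}_{\le q}$. Choose $\tilde X\in\mathrm{ERFD}(X;f,q,\underline{\alpha},\overline{\alpha},\beta,c,\kappa_1,\kappa_2)$. If $\sigma_q(X)\in(0,\Delta]$, choose $\hat X\in P_{\mathbb{R}^{m\times n}_{q-1}}(X)$ and $\tilde X^{\mathrm R}\in\mathrm{ERFD}(\hat X;f,q,\underline{\alpha},\overline{\alpha},\beta,c,\kappa_1,\kappa_2)$, and return some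 $Y\in\operatorname{argmin}_{\{\tilde X,\tilde X^{\mathrm R}\}}f$; otherwise return $\tilde X$. The set of all possible outputs is $\mathrm{ERFDR}(X;f,q,\underline{\alpha},\overline{\alpha},\beta,c,\kappa_1,\kappa_2,\Delta)$. $\mathrm{ERFDR}$ algorithm on $(Y_0;f,q,\underline{\alpha},\overline{\alpha},\beta,c,\kappa_1,\kappa_2,\Delta)$, $Y_0\in\mathbb{R}^{m\times n}_{\le q}$. Starting from $j=0$: while $\mathrm{s}(Y_j;f,\mathbb{R}^{m\times n}_{\le q})>0$, choose any $\Delta_j\in[\Delta,\infty)$, choose any $Y_{j+1}\in\mathrm{ERFDR}(Y_j;f,q,\underline{\alpha},\overline{\alpha},\beta,c,\kappa_1,\kappa_2,\Delta_j)$, and increment $j$. Rank-increasing $\mathrm{ERFDR}$ algorithm. Starting from $(X_0,r_0)$ and $i=0$: while $\mathrm{s}(X_i;f,\mathbb{R}^{m\times n}_{\le r_i})>0$, (1) iterate the $\mathrm{ERFDR}$ algorithm on $(X_i;f,r_i,\underline{\alpha},\overline{\alpha},\beta,c,\kappa_1,\kappa_2,\Delta)$ at least once (finitely many iterations) to compute $X_{i+1}\in\mathbb{R}^{m\times n}_{\le r_i}$ such that $\mathrm{s}(X_{i+1};f,\mathbb{R}^{m\times n}_{\le r_i})\le\tau^i\varepsilon$; (2) choose any $r_{i+1}\in\{r_i,\dots,r\}$; (3) increment $i$. If the loop terminates, $i_*$ is the final value of $i$; otherwise $i_*=\infty$. Since $(r_i)$ is nondecreasing, integer-valued and bounded above by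 $r$, it is eventually constant when $i_*=\infty$. *)

theory Defs
  imports "HOL-Analysis.Analysis" "HOL-Library.While_Combinator"
begin

text \<open>An \<open>m \<times> n\<close> real matrix is an element of \<^typ>\<open>real^'n^'m\<close>, with \<open>m = CARD('m)\<close> and
  \<open>n = CARD('n)\<close>. The library inner product and norm on this type are the Frobenius ones.\<close>

lemma inner_matrix_eq_trace:
  fixes X Y :: "real^'n^'m"
  shows "X \<bullet> Y = trace (transpose Y ** X)"
  unfolding trace_def transpose_def matrix_matrix_mult_def inner_vec_def
  by (simp add: mult.commute) (rule sum.swap)

definition rank_le :: "nat \<Rightarrow> (real^'n^'m) set" where
  "rank_le q = {X. rank X \<le> q}"

definition rank_eq :: "nat \<Rightarrow> (real^'n^'m) set" where
  "rank_eq q = {X. rank X = q}"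

text \<open>\<open>is_svd X s u v\<close>: \<open>X = \<Sum>\<^sub>i s\<^sub>i u\<^sub>i v\<^sub>i\<^sup>T\<close> is a thin singular value decomposition, with indices
  in \<open>{1..min m n}\<close>. The values of \<open>s\<close>, \<open>u\<close>, \<open>v\<close> at other indices are irrelevant.\<close>

definition is_svd ::
  "real^'n^'m \<Rightarrow> (nat \<Rightarrow> real) \<Rightarrow> (nat \<Rightarrow> real^'m) \<Rightarrow> (nat \<Rightarrow> real^'n) \<Rightarrow> bool" where
  "is_svd X s u v \<longleftrightarrow>
     (let I = {1..min CARD('m) CARD('n)} in
        (\<forall>i\<in>I. 0 \<le> s i) \<and>
        (\<forall>i\<in>I. \<forall>j\<in>I. i \<le> j \<longrightarrow> s j \<le> s i) \<and>
        (\<forall>i\<in>I. \<forall>j\<in>I. u i \<bullet> u j = (if i = j then 1 else 0)) \<and>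
        (\<forall>i\<in>I. \<forall>j\<in>I. v i \<bullet> v j = (if i = j then 1 else 0)) \<and>
        X = (\<chi> a b. \<Sum>i\<in>I. s i * u i $ a * v i $ b))"

text \<open>The \<open>k\<close>-th largest singular value, meaningful for \<open>k\<close> in \<open>{1..min m n}\<close>: the singular vectors
  are not unique, but the \<open>k\<close>-th diagonal entry is the same in every decomposition.\<close>

definition singular_value :: "nat \<Rightarrow> real^'n^'m \<Rightarrow> real" where
  "singular_value k X = (THE t. \<exists>s u v. is_svd X s u v \<and> t = s k)"

definition grad :: "('a::real_inner \<Rightarrow> real) \<Rightarrow> 'a \<Rightarrow> 'a" where
  "grad f x = (THE D. GDERIV f x :> D)"

definition locally_lipschitz_grad :: "('a::real_inner \<Rightarrow> real) \<Rightarrow> bool" where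
  "locally_lipschitz_grad f \<longleftrightarrow>
     (\<forall>x \<rho>. \<exists>L. L-lipschitz_on (cball x \<rho>) (grad f))"

definition proj_set :: "'a::metric_space set \<Rightarrow> 'a \<Rightarrow> 'a set" where
  "proj_set S x = {y. is_arg_min (dist x) (\<lambda>y. y \<in> S) y}"

definition tangent_cone :: "'a::real_normed_vector set \<Rightarrow> 'a \<Rightarrow> 'a set" where
  "tangent_cone S x =
     {z. \<exists>xs t. (\<forall>i::nat. xs i \<in> S) \<and> xs \<longlonglongrightarrow> x \<and> (\<forall>i. 0 < (t i :: real)) \<and>
         (\<lambda>i. (xs i - x) /\<^sub>R t i) \<longlonglongrightarrow> z}"

text \<open>The common norm of all projections of \<open>-\<nabla>f(X)\<close> onto the (closed) tangent
  cone at \<open>X\<close>, for \<open>X\<close> of rank at most \<open>q\<close>.\<close>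

definition stat_measure :: "(real^'n^'m \<Rightarrow> real) \<Rightarrow> nat \<Rightarrow> real^'n^'m \<Rightarrow> real" where
  "stat_measure f q X =
     (THE d. \<exists>G \<in> proj_set (tangent_cone (rank_le q) X) (- grad f X). d = norm G)"

definition b_stationary :: "(real^'n^'m \<Rightarrow> real) \<Rightarrow> nat \<Rightarrow> real^'n^'m \<Rightarrow> bool" where
  "b_stationary f q X \<longleftrightarrow>
     X \<in> rank_le q \<and> (\<forall>Z \<in> tangent_cone (rank_le q) X. 0 \<le> grad f X \<bullet> Z)"

text \<open>The parameters \<open>a\<close> and \<open>b\<close> below are the lower and upper bounds on the initial step size.
  The \<^const>\<open>while_option\<close> term is the backtracking loop; a run in which that loop does not
  terminate has no output.\<close>

definition ERFD ::
  "(real^'n^'m \<Rightarrow> real) \<Rightarrow> nat \<Rightarrow> real \<Rightarrow> real \<Rightarrow> real \<Rightarrow> real \<Rightarrow> real \<Rightarrow> real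
     \<Rightarrow> real^'n^'m \<Rightarrow> (real^'n^'m) set" where
  "ERFD f q a b \<beta> c \<kappa>\<^sub>1 \<kappa>\<^sub>2 X =
     {X + \<alpha> *\<^sub>R G | G \<alpha>\<^sub>0 \<alpha>.
        G \<bullet> (- grad f X) \<ge> max (\<kappa>\<^sub>1 * (stat_measure f q X)\<^sup>2) (\<kappa>\<^sub>2 * (norm G)\<^sup>2) \<and>
        (\<forall>\<gamma>\<in>{0..b}. X + \<gamma> *\<^sub>R G \<in> rank_le q) \<and>
        \<alpha>\<^sub>0 \<in> {a..b} \<and>
        while_option (\<lambda>\<alpha>. f (X + \<alpha> *\<^sub>R G) > f X + c * \<alpha> * (grad f X \<bullet> G)) (\<lambda>\<alpha>. \<alpha> * \<beta>) \<alpha>\<^sub>0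
          = Some \<alpha>}"

definition ERFDR ::
  "(real^'n^'m \<Rightarrow> real) \<Rightarrow> nat \<Rightarrow> real \<Rightarrow> real \<Rightarrow> real \<Rightarrow> real \<Rightarrow> real \<Rightarrow> real \<Rightarrow> real
     \<Rightarrow> real^'n^'m \<Rightarrow> (real^'n^'m) set" where
  "ERFDR f q a b \<beta> c \<kappa>\<^sub>1 \<kappa>\<^sub>2 \<Delta> X =
     (if singular_value q X \<in> {0<..\<Delta>}
      then {Y. \<exists>X' \<in> ERFD f q a b \<beta> c \<kappa>\<^sub>1 \<kappa>\<^sub>2 X.
               \<exists>Xh \<in> proj_set (rank_eq (q - 1)) X.
               \<exists>XR \<in> ERFD f q a b \<beta> c \<kappa>\<^sub>1 \<kappa>\<^sub>2 Xh.
                 is_arg_min f (\<lambda>Z. Z \<in> {X', XR}) Y}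
      else ERFD f q a b \<beta> c \<kappa>\<^sub>1 \<kappa>\<^sub>2 X)"

text \<open>One iteration of the loop of the ERFDR algorithm, including the loop guard. Its transitive
  closure relates \<open>Y\<^sub>0\<close> to every iterate \<open>Y\<^sub>k\<close> with finite \<open>k \<ge> 1\<close>.\<close>

definition ERFDR_step ::
  "(real^'n^'m \<Rightarrow> real) \<Rightarrow> nat \<Rightarrow> real \<Rightarrow> real \<Rightarrow> real \<Rightarrow> real \<Rightarrow> real \<Rightarrow> real \<Rightarrow> real
     \<Rightarrow> real^'n^'m \<Rightarrow> real^'n^'m \<Rightarrow> bool" where
  "ERFDR_step f q a b \<beta> c \<kappa>\<^sub>1 \<kappa>\<^sub>2 \<Delta> Y Y' \<longleftrightarrow>
     stat_measure f q Y > 0 \<and> (\<exists>\<Delta>'\<in>{\<Delta>..}. Y' \<in> ERFDR f q a b \<beta> c \<kappa>\<^sub>1 \<kappa>\<^sub>2 \<Delta>' Y)"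

text \<open>\<open>(X i, rs i)\<close> for \<open>i \<le> N\<close> is a complete run of the rank-increasing algorithm from
  \<open>(X\<^sub>0, r\<^sub>0)\<close>; the values of \<open>X\<close> and \<open>rs\<close> beyond a finite \<open>N\<close> are unconstrained.\<close>

definition rank_increasing_ERFDR_run ::
  "(real^'n^'m \<Rightarrow> real) \<Rightarrow> nat \<Rightarrow> real \<Rightarrow> real \<Rightarrow> real \<Rightarrow> real \<Rightarrow> real \<Rightarrow> real \<Rightarrow> real
     \<Rightarrow> real \<Rightarrow> real \<Rightarrow> real^'n^'m \<Rightarrow> nat
     \<Rightarrow> (nat \<Rightarrow> real^'n^'m) \<Rightarrow> (nat \<Rightarrow> nat) \<Rightarrow> enat \<Rightarrow> bool" where
  "rank_increasing_ERFDR_run f r a b \<beta> c \<kappa>\<^sub>1 \<kappa>\<^sub>2 \<Delta> \<tau> \<epsilon> X\<^sub>0 r\<^sub>0 X rs N \<longleftrightarrow>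
     X 0 = X\<^sub>0 \<and> rs 0 = r\<^sub>0 \<and>
     (\<forall>i. enat i < N \<longrightarrow>
        stat_measure f (rs i) (X i) > 0 \<and>
        (ERFDR_step f (rs i) a b \<beta> c \<kappa>\<^sub>1 \<kappa>\<^sub>2 \<Delta>)\<^sup>+\<^sup>+ (X i) (X (Suc i)) \<and>
        X (Suc i) \<in> rank_le (rs i) \<and>
        stat_measure f (rs i) (X (Suc i)) \<le> \<tau> ^ i * \<epsilon> \<and>
        rs (Suc i) \<in> {rs i..r}) \<and>
     (\<forall>i. N = enat i \<longrightarrow> \<not> stat_measure f (rs i) (X i) > 0)"

definition accumulation_point :: "(nat \<Rightarrow> 'a::topological_space) \<Rightarrow> 'a \<Rightarrow> bool" where
  "accumulation_point xs x \<longleftrightarrow> (\<exists>\<phi>. strict_mono \<phi> \<and> (xs \<circ> \<phi>) \<longlonglongrightarrow> x)"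

end

theory Submission
  imports Defs
begin

text \<open>
  Let \<open>q\<close> be the final rank bound and \<open>Z\<close> an accumulation point of the iterates. The tolerances in the
  loop give convergence of the stationarity measure to \<open>0\<close> along the iterates, and every step
  decreases \<open>f\<close>, so the bounded sublevel set provides accumulation points and \<open>f (X\<^sub>i)\<close> decreases to
  \<open>f Z\<close>. What requires an argument is that \<open>Z\<close> is stationary: the measure is not lower
  semicontinuous on the matrices of rank at most \<open>q\<close>, since the tangent cone grows abruptly where
  the rank drops.

  If \<open>rank Z = q\<close>, the tangent space varies continuously near \<open>Z\<close> and the measure passes to
  the limit (\<open>b_stationary_limit_full_rank\<close>). This rests on a description of the tangent cone at
  \<open>Z\<close>: tangent matrices map the kernel of \<open>Z\<close> into its range (\<open>tangent_cone_normal_block\<close>).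

  If \<open>rank Z < q\<close>, one iteration of the inner algorithm started from an iterate near \<open>Z\<close> is used.
  Either the iterate has rank below \<open>q\<close>, or its \<open>q\<close>-th singular value is below the threshold, so that the
  iteration also searches from a nearby matrix of rank \<open>q - 1\<close>. The search decreases \<open>f\<close> by
  a uniform multiple of the squared measure (\<open>ERFD_sufficient_decrease\<close>), while \<open>f\<close> has almost
  reached its limit; hence the measure is small at matrices of rank below \<open>q\<close> near \<open>Z\<close>. There it
  dominates every entry of the gradient, because all rank-one directions are tangent, and
  \<open>\<nabla>f\<close> vanishes at \<open>Z\<close> (\<open>b_stationary_limit_of_ERFDR_steps\<close>).

  Reduction takes place near \<open>Z\<close> because the \<open>q\<close>-th singular value of a matrix \<open>Y\<close> is well defined
  (\<open>svd_exists\<close>, \<open>svd_le_svd\<close>) and at most the distance from \<open>Y\<close> to any matrix of rank below \<open>q\<close>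
  (\<open>singular_value_le_norm_diff\<close>).
\<close>

section \<open>Orthonormal families\<close>

definition orthonormal_on :: "'i set \<Rightarrow> ('i \<Rightarrow> 'a::real_inner) \<Rightarrow> bool" where
  "orthonormal_on I u \<longleftrightarrow> (\<forall>i\<in>I. \<forall>j\<in>I. u i \<bullet> u j = (if i = j then 1 else 0))"

lemma orthonormal_on_subset: "orthonormal_on I u \<Longrightarrow> J \<subseteq> I \<Longrightarrow> orthonormal_on J u"
  unfolding orthonormal_on_def by blast

lemma orthonormal_on_norm: "orthonormal_on I u \<Longrightarrow> i \<in> I \<Longrightarrow> norm (u i) = 1"
  by (simp add: orthonormal_on_def norm_eq_sqrt_inner)

lemma inner_orthonormal_sum:
  assumes "orthonormal_on I u" "finite I" "j \<in> I"
  shows "u j \<bullet> (\<Sum>i\<in>I. c i *\<^sub>R u i) = c j"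
proof -
  have "u j \<bullet> (\<Sum>i\<in>I. c i *\<^sub>R u i) = (\<Sum>i\<in>I. c i * (u j \<bullet> u i))"
    by (simp add: inner_sum_right)
  also have "\<dots> = (\<Sum>i\<in>I. if i = j then c i else 0)"
    using assms by (intro sum.cong) (auto simp: orthonormal_on_def)
  finally show ?thesis
    using assms by simp
qed

lemma norm_orthonormal_sum:
  assumes "orthonormal_on I u" "finite I"
  shows "(norm (\<Sum>i\<in>I. c i *\<^sub>R u i))\<^sup>2 = (\<Sum>i\<in>I. (c i)\<^sup>2)"
proof -
  have "(norm (\<Sum>i\<in>I. c i *\<^sub>R u i))\<^sup>2 = (\<Sum>i\<in>I. c i * (u i \<bullet> (\<Sum>i\<in>I. c i *\<^sub>R u i)))"
    by (simp add: power2_norm_eq_inner inner_sum_left)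
  also have "\<dots> = (\<Sum>i\<in>I. (c i)\<^sup>2)"
    using assms by (intro sum.cong) (auto simp: inner_orthonormal_sum power2_eq_square)
  finally show ?thesis .
qed

lemma Bessel_inequality:
  assumes "orthonormal_on I u" "finite I"
  shows "(\<Sum>i\<in>I. (u i \<bullet> x)\<^sup>2) \<le> (norm x)\<^sup>2"
proof -
  let ?p = "\<Sum>i\<in>I. (u i \<bullet> x) *\<^sub>R u i"
  have "x \<bullet> ?p = (\<Sum>i\<in>I. (u i \<bullet> x)\<^sup>2)"
    by (simp add: inner_sum_right power2_eq_square inner_commute)
  moreover have "?p \<bullet> ?p = (\<Sum>i\<in>I. (u i \<bullet> x)\<^sup>2)"
    using norm_orthonormal_sum[OF assms] by (simp add: power2_norm_eq_inner)
  moreover have "(norm (x - ?p))\<^sup>2 = x \<bullet> x - 2 * (x \<bullet> ?p) + ?p \<bullet> ?p"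
    by (simp add: power2_norm_eq_inner algebra_simps inner_commute)
  ultimately show ?thesis
    using zero_le_power2[of "norm (x - ?p)"] by (simp add: power2_norm_eq_inner)
qed

lemma orthonormal_expansion:
  assumes "orthonormal_on I u" "finite I" "x \<in> span (u ` I)"
  shows "x = (\<Sum>i\<in>I. (u i \<bullet> x) *\<^sub>R u i)"
  using assms(3)
proof (induction rule: span_induct_alt)
  case base
  show ?case by simp
next
  case (step c y z)
  then obtain j where j: "j \<in> I" "y = u j" by auto
  have "(\<Sum>i\<in>I. (u i \<bullet> u j) *\<^sub>R u i) = (\<Sum>i\<in>I. if i = j then u i else 0)"
    using assms(1) j(1) by (intro sum.cong) (auto simp: orthonormal_on_def)
  also have "\<dots> = u j"
    using assms(2) j(1) by simp
  finally have "(\<Sum>i\<in>I. (u i \<bullet> y) *\<^sub>R u i) = y"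
    by (simp add: j)
  then have "(\<Sum>i\<in>I. (u i \<bullet> (c *\<^sub>R y + z)) *\<^sub>R u i) = c *\<^sub>R y + (\<Sum>i\<in>I. (u i \<bullet> z) *\<^sub>R u i)"
    by (simp add: inner_add_right scaleR_add_left sum.distrib flip: scaleR_scaleR scaleR_sum_right)
  then show ?case
    using step by simp
qed

lemma dim_orthonormal_span:
  fixes u :: "'i \<Rightarrow> 'a::euclidean_space"
  assumes "orthonormal_on I u"
  shows "dim (span (u ` I)) = card I"
proof -
  have inj: "inj_on u I"
  proof (rule inj_onI, rule ccontr)
    fix i j assume ij: "i \<in> I" "j \<in> I" "u i = u j" "i \<noteq> j"
    then have "u i \<bullet> u j = (if i = j then 1 else 0)" "u i \<bullet> u i = (if i = i then 1 else 0)"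
      using assms unfolding orthonormal_on_def by blast+
    then show False using ij by simp
  qed
  have "pairwise orthogonal (u ` I)" "0 \<notin> u ` I"
    using assms orthonormal_on_norm[OF assms]
    by (force simp: pairwise_def orthogonal_def orthonormal_on_def)+
  then have "independent (u ` I)"
    by (rule pairwise_orthogonal_independent)
  then show ?thesis
    using dim_span_eq_card_independent card_image[OF inj] by metis
qed

lemma orthonormal_extend:
  fixes u :: "'i \<Rightarrow> 'a::euclidean_space"
  assumes "orthonormal_on I u" "card I < DIM('a)"
  obtains w where "norm w = 1" "\<And>i. i \<in> I \<Longrightarrow> u i \<bullet> w = 0"
proof -
  have "dim (span (u ` I)) < DIM('a)"
    using assms by (simp only: dim_orthonormal_span)
  then obtain x where x: "x \<noteq> 0" "\<And>y. y \<in> span (span (u ` I)) \<Longrightarrow> orthogonal x y"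
    by (rule orthogonal_to_subspace_exists) blast
  show thesis
  proof (rule that[of "x /\<^sub>R norm x"])
    show "norm (x /\<^sub>R norm x) = 1"
      using x(1) by simp
    show "u i \<bullet> (x /\<^sub>R norm x) = 0" if "i \<in> I" for i
      using x(2)[of "u i"] that
      by (simp add: orthogonal_def inner_commute span_base)
  qed
qed

lemma orthonormal_complete:
  fixes u :: "'i \<Rightarrow> 'a::euclidean_space"
  assumes "orthonormal_on I u" "card I = DIM('a)" "\<And>i. i \<in> I \<Longrightarrow> u i \<bullet> x = 0"
  shows "x = 0"
proof -
  have "dim (u ` I) = DIM('a)"
    using dim_orthonormal_span[OF assms(1)] assms(2) by simp
  then have "x \<in> span (u ` I)"
    using dim_eq_full by blast
  then have "orthogonal x x"
    by (rule orthogonal_to_span) (use assms(3) in \<open>auto simp: orthogonal_def inner_commute\<close>)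
  then show ?thesis
    by (simp add: orthogonal_def)
qed

section \<open>Outer products\<close>

definition outer :: "real^'m \<Rightarrow> real^'n \<Rightarrow> real^'n^'m" where
  "outer u v = (\<chi> a b. u $ a * v $ b)"

lemma outer_mult: "outer u v *v x = (v \<bullet> x) *\<^sub>R u"
  by (simp add: outer_def matrix_vector_mult_def vec_eq_iff inner_vec_def sum_distrib_left
      mult.assoc mult.commute mult.left_commute)

lemma inner_outer: "M \<bullet> outer u v = u \<bullet> (M *v v)"
  by (simp add: outer_def matrix_vector_mult_def inner_vec_def sum_distrib_left
      mult.assoc mult.commute mult.left_commute)

lemma norm_outer: "norm (outer u v) = norm u * norm v"
proof -
  have "outer u v \<bullet> outer u v = (norm u)\<^sup>2 * (norm v)\<^sup>2"
    by (simp add: inner_outer outer_mult power2_norm_eq_inner mult.commute)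
  then show ?thesis
    by (simp add: norm_eq_sqrt_inner[of "outer u v"] real_sqrt_mult)
qed

lemma outer_scaleR_left: "outer (c *\<^sub>R p) z = c *\<^sub>R outer p z"
  by (simp add: outer_def vec_eq_iff)

lemma inner_matrix_vector_mult:
  fixes A :: "real^'n^'m"
  shows "(A *v x) \<bullet> y = x \<bullet> (transpose A *v y)"
  by (metis dot_lmul_matrix inner_commute transpose_matrix_vector)

lemma norm_matrix_vector_mult_le:
  fixes A :: "real^'n^'m"
  shows "norm (A *v x) \<le> norm A * norm x"
proof -
  have "(norm (A *v x))\<^sup>2 = A \<bullet> outer (A *v x) x"
    by (simp add: inner_outer power2_norm_eq_inner)
  also have "\<dots> \<le> norm A * norm x * norm (A *v x)"
    using norm_cauchy_schwarz[of A "outer (A *v x) x"] by (simp add: norm_outer mult_ac)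
  finally show ?thesis
    by (cases "A *v x = 0") (simp_all add: power2_eq_square)
qed

abbreviation outer_sum ::
  "'i set \<Rightarrow> ('i \<Rightarrow> real) \<Rightarrow> ('i \<Rightarrow> real^'m) \<Rightarrow> ('i \<Rightarrow> real^'n) \<Rightarrow> real^'n^'m" where
  "outer_sum I s u v \<equiv> (\<Sum>i\<in>I. s i *\<^sub>R outer (u i) (v i))"

lemma matrix_vector_mult_sum_left:
  fixes A :: "'i \<Rightarrow> real^'n^'m"
  shows "(\<Sum>i\<in>I. A i) *v x = (\<Sum>i\<in>I. A i *v x)"
  by (induction I rule: infinite_finite_induct) (simp_all add: matrix_vector_mult_add_rdistrib)

lemma outer_sum_mult: "outer_sum I s u v *v x = (\<Sum>i\<in>I. (s i * (v i \<bullet> x)) *\<^sub>R u i)"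
  by (simp add: matrix_vector_mult_sum_left outer_mult flip: scaleR_matrix_vector_assoc)

lemma rank_outer_sum:
  fixes u :: "'i \<Rightarrow> real^'m" and v :: "'i \<Rightarrow> real^'n"
  assumes "orthonormal_on I u" "orthonormal_on I v" "finite I"
  shows "rank (outer_sum I s u v) = card {i\<in>I. s i \<noteq> 0}"
proof -
  let ?X = "outer_sum I s u v" and ?J = "{i\<in>I. s i \<noteq> 0}"
  have "range (\<lambda>x. ?X *v x) \<subseteq> span (u ` ?J)"
  proof clarify
    fix x
    have "?X *v x = (\<Sum>i\<in>?J. (s i * (v i \<bullet> x)) *\<^sub>R u i)"
      unfolding outer_sum_mult using assms(3) by (intro sum.mono_neutral_right) auto
    also have "\<dots> \<in> span (u ` ?J)"
      by (intro span_sum span_scale span_base) auto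
    finally show "?X *v x \<in> span (u ` ?J)" .
  qed
  moreover have "span (u ` ?J) \<subseteq> range (\<lambda>x. ?X *v x)"
  proof (rule span_minimal)
    show "subspace (range (\<lambda>x. ?X *v x))"
      by (intro linear_subspace_image) auto
    show "u ` ?J \<subseteq> range (\<lambda>x. ?X *v x)"
    proof clarify
      fix j assume j: "j \<in> I" "s j \<noteq> 0"
      have "?X *v (v j /\<^sub>R s j) = (\<Sum>i\<in>I. if i = j then u i else 0)"
        unfolding outer_sum_mult using assms(2) j
        by (intro sum.cong) (auto simp: orthonormal_on_def)
      also have "\<dots> = u j"
        using j assms(3) by simp
      finally show "u j \<in> range (\<lambda>x. ?X *v x)"
        by (metis rangeI)
    qed
  qed
  ultimately have "range (\<lambda>x. ?X *v x) = span (u ` ?J)"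
    by (rule subset_antisym)
  then have "rank ?X = dim (span (u ` ?J))"
    by (simp only: rank_dim_range)
  also have "\<dots> = card ?J"
    by (intro dim_orthonormal_span orthonormal_on_subset[OF assms(1)]) auto
  finally show ?thesis .
qed

section \<open>The singular value decomposition\<close>

lemma is_svd_iff:
  fixes X :: "real^'n^'m"
  shows "is_svd X s u v \<longleftrightarrow>
     (\<forall>i\<in>{1..min CARD('m) CARD('n)}. 0 \<le> s i) \<and>
     antimono_on {1..min CARD('m) CARD('n)} s \<and>
     orthonormal_on {1..min CARD('m) CARD('n)} u \<and>
     orthonormal_on {1..min CARD('m) CARD('n)} v \<and>
     X = outer_sum {1..min CARD('m) CARD('n)} s u v"
proof -
  have "(\<chi> a b. \<Sum>i\<in>I. s i * u i $ a * v i $ b) = outer_sum I s u v" for I :: "nat set"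
    by (simp add: vec_eq_iff outer_def sum_component mult.assoc)
  then show ?thesis
    by (simp add: is_svd_def Let_def orthonormal_on_def monotone_on_def)
qed

text \<open>The decomposition is built greedily: the next right singular vector \<open>w\<close> maximises
  \<open>norm (A *v x)\<close> over the unit sphere of the orthogonal complement \<open>W\<close> of those already found.
  Maximality forces \<open>A *v x\<close> to be orthogonal to \<open>A *v w\<close> for \<open>x\<close> in \<open>W\<close> orthogonal to \<open>w\<close>, and the
  equations for the transpose keep this true for the earlier vectors, so that \<open>A\<^sup>T A w = t\<^sup>2 w\<close>. The
  final conjunct is the part of the induction hypothesis that makes the singular values decrease.\<close>

lemma partial_svd:
  fixes A :: "real^'n^'m"
  assumes "k \<le> min CARD('m) CARD('n)"
  shows "\<exists>s u v. orthonormal_on {1..k} u \<and> orthonormal_on {1..k} v \<and>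
    antimono_on {1..k} s \<and>
    (\<forall>i\<in>{1..k}. 0 \<le> s i \<and> A *v v i = s i *\<^sub>R u i \<and> transpose A *v u i = s i *\<^sub>R v i) \<and>
    (\<forall>x. (\<forall>i\<in>{1..k}. v i \<bullet> x = 0) \<longrightarrow> (\<forall>i\<in>{1..k}. norm (A *v x) \<le> s i * norm x))"
  using assms
proof (induction k)
  case 0
  show ?case by (simp add: orthonormal_on_def monotone_on_def)
next
  case (Suc k)
  then obtain s u v where ou: "orthonormal_on {1..k} u" and ov: "orthonormal_on {1..k} v"
    and anti: "antimono_on {1..k} s"
    and s0: "\<And>i. i \<in> {1..k} \<Longrightarrow> 0 \<le> s i"
    and Av: "\<And>i. i \<in> {1..k} \<Longrightarrow> A *v v i = s i *\<^sub>R u i"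
    and Au: "\<And>i. i \<in> {1..k} \<Longrightarrow> transpose A *v u i = s i *\<^sub>R v i"
    and bound: "\<And>x i. (\<And>j. j \<in> {1..k} \<Longrightarrow> v j \<bullet> x = 0) \<Longrightarrow> i \<in> {1..k} \<Longrightarrow> norm (A *v x) \<le> s i * norm x"
    by force
  define W where "W = {x. \<forall>i\<in>{1..k}. v i \<bullet> x = 0}"
  have subW: "subspace W"
    by (auto simp: W_def subspace_def inner_add_right)
  have "closed W"
    by (rule closed_subspace[OF subW])
  then have "compact (sphere 0 1 \<inter> W)"
    by (intro compact_Int_closed compact_sphere)
  moreover have "sphere 0 1 \<inter> W \<noteq> {}"
  proof -
    obtain w where "norm w = 1" "\<And>i. i \<in> {1..k} \<Longrightarrow> v i \<bullet> w = 0"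
      using orthonormal_extend[OF ov] Suc.prems by auto
    then have "w \<in> sphere 0 1 \<inter> W" by (simp add: W_def)
    then show ?thesis by blast
  qed
  moreover have "continuous_on (sphere 0 1 \<inter> W) (\<lambda>x. norm (A *v x))"
    by (intro continuous_intros)
  ultimately have "\<exists>w\<in>sphere 0 1 \<inter> W. \<forall>x\<in>sphere 0 1 \<inter> W. norm (A *v x) \<le> norm (A *v w)"
    by (rule continuous_attains_sup)
  then obtain w where "w \<in> sphere 0 1 \<inter> W"
    and wmax: "\<And>x. x \<in> sphere 0 1 \<inter> W \<Longrightarrow> norm (A *v x) \<le> norm (A *v w)"
    by blast
  then have w1: "norm w = 1" and wW: "w \<in> W" by auto
  define t where "t = norm (A *v w)"
  have tmax: "norm (A *v x) \<le> t * norm x" if "x \<in> W" for x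
  proof (cases "x = 0")
    case False
    then have "norm (A *v (x /\<^sub>R norm x)) \<le> t"
      unfolding t_def by (intro wmax) (use subspace_scale[OF subW that] in auto)
    then show ?thesis
      using False by (simp add: matrix_vector_mult_scaleR field_simps)
  qed simp
  have vw: "v i \<bullet> w = 0" if "i \<in> {1..k}" for i
    using wW that by (simp add: W_def)
  have crit: "(A *v x) \<bullet> (A *v w) = t\<^sup>2 * (x \<bullet> w)" if "x \<in> W" for x
  proof -
    define y where "y = x - (x \<bullet> w) *\<^sub>R w"
    have yW: "y \<in> W"
      unfolding y_def by (intro subspace_diff subspace_scale subW that wW)
    have ww: "w \<bullet> w = 1" using w1 by (simp add: norm_eq_1)
    have yw: "y \<bullet> w = 0"
      by (simp add: y_def inner_diff_left ww)
    define b where "b = (A *v y) \<bullet> (A *v w)"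
    \<comment> \<open>The maximum at \<open>w\<close>, compared with its value at the perturbed vector \<open>w + e y\<close>; the term linear
      in \<open>e\<close> dominates near \<open>0\<close> unless \<open>b\<close> vanishes.\<close>
    have quad: "2 * e * b \<le> e\<^sup>2 * (t\<^sup>2 * (y \<bullet> y))" for e
    proof -
      have "(norm (A *v (w + e *\<^sub>R y)))\<^sup>2 \<le> (t * norm (w + e *\<^sub>R y))\<^sup>2"
        by (intro power_mono tmax subspace_add subspace_scale subW wW yW) auto
      also have "\<dots> = t\<^sup>2 * (1 + e\<^sup>2 * (y \<bullet> y))"
        unfolding power_mult_distrib power2_norm_eq_inner using yw
        by (simp add: inner_add_left inner_add_right ww inner_commute power2_eq_square)
      finally have "(norm (A *v (w + e *\<^sub>R y)))\<^sup>2 \<le> t\<^sup>2 * (1 + e\<^sup>2 * (y \<bullet> y))" .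
      moreover have "(norm (A *v (w + e *\<^sub>R y)))\<^sup>2 = t\<^sup>2 + 2 * e * b + (norm (e *\<^sub>R (A *v y)))\<^sup>2"
        unfolding t_def b_def power2_norm_eq_inner
        by (simp add: matrix_vector_right_distrib matrix_vector_mult_scaleR
            inner_add_left inner_add_right inner_commute)
      ultimately have "2 * e * b + (norm (e *\<^sub>R (A *v y)))\<^sup>2 \<le> e\<^sup>2 * (t\<^sup>2 * (y \<bullet> y))"
        by (simp add: distrib_left mult_ac)
      then show ?thesis
        using zero_le_power2[of "norm (e *\<^sub>R (A *v y))"] by linarith
    qed
    have "b = 0"
    proof (rule ccontr)
      assume "b \<noteq> 0"
      define d where "d = t\<^sup>2 * (y \<bullet> y) + 1"
      have d: "d > 0" unfolding d_def by (intro add_nonneg_pos) auto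
      have "2 * (b / d) * b \<le> (b / d)\<^sup>2 * (d - 1)"
        using quad[of "b / d"] by (simp add: d_def)
      then have "2 * (b\<^sup>2 / d) \<le> (b\<^sup>2 / d) * ((d - 1) / d)"
        by (simp add: power2_eq_square)
      also have "\<dots> \<le> (b\<^sup>2 / d) * 1"
        using d by (intro mult_left_mono) auto
      finally show False
        using d \<open>b \<noteq> 0\<close> by (simp add: field_simps)
    qed
    have "A *v y = A *v x - (x \<bullet> w) *\<^sub>R (A *v w)"
      by (simp add: y_def matrix_vector_mult_diff_distrib matrix_vector_mult_scaleR)
    then have "b = (A *v x) \<bullet> (A *v w) - (x \<bullet> w) * ((A *v w) \<bullet> (A *v w))"
      by (simp add: b_def inner_diff_left)
    then show ?thesis
      by (simp add: \<open>b = 0\<close> t_def power2_norm_eq_inner)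
  qed
  have uAx: "u i \<bullet> (A *v x) = s i * (v i \<bullet> x)" if "i \<in> {1..k}" for i x
    using Au[OF that] inner_matrix_vector_mult[of A x "u i"] by (simp add: inner_commute)
  \<comment> \<open>If \<open>t = 0\<close> then \<open>A\<close> vanishes on \<open>W\<close> and any unit vector completing the \<open>u i\<close> will do.\<close>
  obtain z where z1: "norm z = 1" and uz: "\<And>i. i \<in> {1..k} \<Longrightarrow> u i \<bullet> z = 0"
    and Aw: "A *v w = t *\<^sub>R z" and Az: "\<And>x. x \<in> W \<Longrightarrow> z \<bullet> (A *v x) = t * (w \<bullet> x)"
  proof (cases "t = 0")
    case True
    obtain z where z: "norm z = 1" "\<And>i. i \<in> {1..k} \<Longrightarrow> u i \<bullet> z = 0"
      using orthonormal_extend[OF ou] Suc.prems by auto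
    show ?thesis
      by (rule that[of z]) (use z True tmax wW in auto)
  next
    case False
    show ?thesis
    proof (rule that[of "(A *v w) /\<^sub>R t"])
      show "norm ((A *v w) /\<^sub>R t) = 1" using False by (simp add: t_def)
      show "u i \<bullet> ((A *v w) /\<^sub>R t) = 0" if "i \<in> {1..k}" for i
        using uAx[OF that] vw[OF that] by simp
      show "A *v w = t *\<^sub>R ((A *v w) /\<^sub>R t)" using False by simp
      show "((A *v w) /\<^sub>R t) \<bullet> (A *v x) = t * (w \<bullet> x)" if "x \<in> W" for x
        using crit[OF that] False
        by (simp add: inner_commute power2_eq_square)
    qed
  qed
  have Atz: "transpose A *v z = t *\<^sub>R w"
  proof (rule vector_eq_rdot[THEN iffD1], rule allI)
    fix x
    define p where "p = (\<Sum>i\<in>{1..k}. (v i \<bullet> x) *\<^sub>R v i)"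
    have "v i \<bullet> p = v i \<bullet> x" if "i \<in> {1..k}" for i
      unfolding p_def by (rule inner_orthonormal_sum[OF ov _ that]) simp
    then have yW: "x - p \<in> W"
      by (simp add: W_def inner_diff_right del: atLeastAtMost_iff One_nat_def)
    have "A *v p = (\<Sum>i\<in>{1..k}. (v i \<bullet> x) *\<^sub>R (s i *\<^sub>R u i))"
      by (simp add: p_def linear_sum[OF matrix_vector_mul_linear]
          matrix_vector_mult_scaleR Av del: atLeastAtMost_iff One_nat_def)
    then have "z \<bullet> (A *v p) = 0"
      using uz by (simp add: inner_sum_right inner_commute del: atLeastAtMost_iff One_nat_def)
    then have "z \<bullet> (A *v x) = z \<bullet> (A *v (x - p))"
      by (simp add: matrix_vector_mult_diff_distrib inner_diff_right)
    also have "\<dots> = t * (w \<bullet> (x - p))"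
      using Az yW by simp
    also have "w \<bullet> (x - p) = w \<bullet> x"
    proof -
      have "w \<bullet> p = 0"
        using vw by (simp add: p_def inner_sum_right inner_commute del: atLeastAtMost_iff One_nat_def)
      then show ?thesis
        by (simp add: inner_diff_right)
    qed
    finally show "(transpose A *v z) \<bullet> x = (t *\<^sub>R w) \<bullet> x"
      using inner_matrix_vector_mult[of A x z] by (simp add: inner_commute)
  qed
  let ?s = "s(Suc k := t)" and ?u = "u(Suc k := z)" and ?v = "v(Suc k := w)"
  have ts: "t \<le> s i" if "i \<in> {1..k}" for i
    using bound[OF vw that] w1 by (simp add: t_def)
  have I: "{1..Suc k} = insert (Suc k) {1..k}" by auto
  have "orthonormal_on {1..Suc k} ?u"
    using ou uz z1 unfolding I orthonormal_on_def
    by (auto simp: inner_commute norm_eq_1)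
  moreover have "orthonormal_on {1..Suc k} ?v"
    using ov vw w1 unfolding I orthonormal_on_def
    by (auto simp: inner_commute norm_eq_1)
  moreover have "antimono_on {1..Suc k} ?s"
    using anti ts unfolding monotone_on_def by (auto simp: le_Suc_eq)
  moreover have "\<forall>i\<in>{1..Suc k}. 0 \<le> ?s i \<and> A *v ?v i = ?s i *\<^sub>R ?u i \<and>
      transpose A *v ?u i = ?s i *\<^sub>R ?v i"
    using s0 Av Au Aw Atz unfolding I by (auto simp: t_def)
  moreover have "\<forall>x. (\<forall>i\<in>{1..Suc k}. ?v i \<bullet> x = 0) \<longrightarrow>
      (\<forall>i\<in>{1..Suc k}. norm (A *v x) \<le> ?s i * norm x)"
  proof (intro allI impI ballI)
    fix x i assume x: "\<forall>i\<in>{1..Suc k}. ?v i \<bullet> x = 0" and i: "i \<in> {1..Suc k}"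
    have vx: "v j \<bullet> x = 0" if "j \<in> {1..k}" for j
      using x[rule_format, of j] that by auto
    then have "x \<in> W" by (simp add: W_def)
    then show "norm (A *v x) \<le> ?s i * norm x"
      using bound[OF vx, of i] tmax i by (cases "i = Suc k") auto
  qed
  ultimately show ?case by blast
qed

text \<open>A maximal partial decomposition is complete because \<open>A\<close> vanishes on the orthogonal complement of
  the right singular vectors: either these span the domain, or the left singular vectors span the
  codomain and every \<open>A *v y\<close> with \<open>y\<close> in that complement is orthogonal to all of them.\<close>

lemma svd_exists:
  fixes A :: "real^'n^'m"
  shows "\<exists>s u v. is_svd A s u v"
proof -
  define k where "k = min CARD('m) CARD('n)"
  obtain s u v where ou: "orthonormal_on {1..k} u" and ov: "orthonormal_on {1..k} v"
    and anti: "antimono_on {1..k} s"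
    and svd: "\<And>i. i \<in> {1..k} \<Longrightarrow> 0 \<le> s i \<and> A *v v i = s i *\<^sub>R u i \<and> transpose A *v u i = s i *\<^sub>R v i"
    using partial_svd[of k A] by (auto simp: k_def)
  have "A *v x = outer_sum {1..k} s u v *v x" for x
  proof -
    define y where "y = x - (\<Sum>i\<in>{1..k}. (v i \<bullet> x) *\<^sub>R v i)"
    have vy: "v i \<bullet> y = 0" if "i \<in> {1..k}" for i
      using that by (simp add: y_def inner_diff_right inner_orthonormal_sum[OF ov] del: atLeastAtMost_iff One_nat_def)
    have "A *v y = 0"
    proof (cases "k = CARD('n)")
      case True
      then show ?thesis
        using orthonormal_complete[OF ov _ vy] by simp
    next
      case False
      then have "k = CARD('m)" by (auto simp: k_def min_def split: if_splits)
      moreover have "u i \<bullet> (A *v y) = 0" if "i \<in> {1..k}" for i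
        using inner_matrix_vector_mult[of A y "u i"] svd[OF that] vy[OF that]
        by (simp add: inner_commute)
      ultimately show ?thesis
        using orthonormal_complete[OF ou] by simp
    qed
    then have "A *v x = A *v (\<Sum>i\<in>{1..k}. (v i \<bullet> x) *\<^sub>R v i)"
      by (simp add: y_def matrix_vector_mult_diff_distrib)
    also have "\<dots> = outer_sum {1..k} s u v *v x"
      unfolding outer_sum_mult using svd
      by (simp add: linear_sum[OF matrix_vector_mul_linear] matrix_vector_mult_scaleR
          mult.commute del: atLeastAtMost_iff One_nat_def)
    finally show ?thesis .
  qed
  then have "A = outer_sum {1..k} s u v"
    by (simp add: matrix_eq)
  then have "is_svd A s u v"
    using ou ov anti svd by (simp add: is_svd_iff k_def)
  then show ?thesis by blast
qed

section \<open>Singular values and low-rank approximation\<close>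

lemma low_rank_kernel_vector:
  fixes Z :: "real^'n^'m"
  assumes "orthonormal_on J v" "rank Z < card J"
  obtains x where "x \<in> span (v ` J)" "x \<noteq> 0" "Z *v x = 0"
proof (rule ccontr)
  assume no: "\<not> thesis"
  have ker: "x = 0" if "x \<in> span (v ` J)" "Z *v x = 0" for x
    using that no \<open>\<And>x. x \<in> span (v ` J) \<Longrightarrow> x \<noteq> 0 \<Longrightarrow> Z *v x = 0 \<Longrightarrow> thesis\<close> by blast
  have "inj_on ((*v) Z) (span (span (v ` J)))"
  proof (rule inj_onI)
    fix x y assume xy: "x \<in> span (span (v ` J))" "y \<in> span (span (v ` J))" "Z *v x = Z *v y"
    have "x - y \<in> span (v ` J)"
      using xy(1,2) by (simp only: span_span span_diff)
    then have "x - y = 0"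
      by (rule ker) (simp add: xy(3) matrix_vector_mult_diff_distrib)
    then show "x = y" by simp
  qed
  then have "dim ((*v) Z ` span (v ` J)) = dim (span (v ` J))"
    by (intro dim_image_eq matrix_vector_mul_linear)
  also have "\<dots> = card J"
    by (rule dim_orthonormal_span[OF assms(1)])
  finally have "card J \<le> rank Z"
    unfolding rank_dim_range by (metis dim_subset image_mono subset_UNIV)
  then show False
    using assms(2) by simp
qed

lemma svd_lower_bound:
  fixes X :: "real^'n^'m"
  assumes svd: "is_svd X s u v" and k: "k \<in> {1..min CARD('m) CARD('n)}"
    and x: "x \<in> span (v ` {1..k})"
  shows "s k * norm x \<le> norm (X *v x)"
proof -
  let ?I = "{1..min CARD('m) CARD('n)}"
  have s0: "\<And>i. i \<in> ?I \<Longrightarrow> 0 \<le> s i" and anti: "antimono_on ?I s"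
    and ou: "orthonormal_on ?I u" and ov: "orthonormal_on ?I v" and X: "X = outer_sum ?I s u v"
    using svd unfolding is_svd_iff by auto
  have sub: "{1..k} \<subseteq> ?I" using k by auto
  have "x = (\<Sum>i\<in>{1..k}. (v i \<bullet> x) *\<^sub>R v i)"
    by (rule orthonormal_expansion[OF orthonormal_on_subset[OF ov sub] _ x]) simp
  then have "(norm x)\<^sup>2 = (\<Sum>i\<in>{1..k}. (v i \<bullet> x)\<^sup>2)"
    using norm_orthonormal_sum[OF orthonormal_on_subset[OF ov sub], of "\<lambda>i. v i \<bullet> x"] by simp
  then have "(s k * norm x)\<^sup>2 = (\<Sum>i\<in>{1..k}. (s k * (v i \<bullet> x))\<^sup>2)"
    by (simp add: power_mult_distrib sum_distrib_left)
  also have "\<dots> \<le> (\<Sum>i\<in>{1..k}. (s i * (v i \<bullet> x))\<^sup>2)"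
  proof (rule sum_mono)
    fix i assume i: "i \<in> {1..k}"
    then have "s k \<le> s i"
      using anti k sub unfolding monotone_on_def by auto
    then show "(s k * (v i \<bullet> x))\<^sup>2 \<le> (s i * (v i \<bullet> x))\<^sup>2"
      using s0[OF k] by (auto simp: power_mult_distrib intro!: mult_right_mono power_mono)
  qed
  also have "\<dots> \<le> (\<Sum>i\<in>?I. (s i * (v i \<bullet> x))\<^sup>2)"
    by (intro sum_mono2 sub) auto
  also have "\<dots> = (norm (X *v x))\<^sup>2"
    unfolding X outer_sum_mult by (rule norm_orthonormal_sum[OF ou, symmetric]) simp
  finally show ?thesis
    by (rule power2_le_imp_le) simp
qed

lemma svd_tail_bound:
  fixes X :: "real^'n^'m"
  assumes svd: "is_svd X s u v" and k: "k \<in> {1..min CARD('m) CARD('n)}"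
  shows "norm ((X - outer_sum {1..<k} s u v) *v x) \<le> s k * norm x"
proof -
  let ?I = "{1..min CARD('m) CARD('n)}"
  define T where "T = {k..min CARD('m) CARD('n)}"
  have s0: "\<And>i. i \<in> ?I \<Longrightarrow> 0 \<le> s i" and anti: "antimono_on ?I s"
    and ou: "orthonormal_on ?I u" and ov: "orthonormal_on ?I v" and X: "X = outer_sum ?I s u v"
    using svd unfolding is_svd_iff by auto
  have sub: "T \<subseteq> ?I" "finite T" using k by (auto simp: T_def)
  have "?I = {1..<k} \<union> T" "{1..<k} \<inter> T = {}"
    using k by (auto simp: T_def)
  then have "X - outer_sum {1..<k} s u v = outer_sum T s u v"
    unfolding X by (simp add: sum.union_disjoint T_def)
  then have "(norm ((X - outer_sum {1..<k} s u v) *v x))\<^sup>2 = (\<Sum>i\<in>T. (s i * (v i \<bullet> x))\<^sup>2)"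
    using norm_orthonormal_sum[OF orthonormal_on_subset[OF ou sub(1)] sub(2)]
    by (simp add: outer_sum_mult)
  also have "\<dots> \<le> (\<Sum>i\<in>T. (s k * (v i \<bullet> x))\<^sup>2)"
  proof (rule sum_mono)
    fix i assume i: "i \<in> T"
    then have "s i \<le> s k" "0 \<le> s i"
      using anti k s0 sub unfolding monotone_on_def T_def by auto
    then show "(s i * (v i \<bullet> x))\<^sup>2 \<le> (s k * (v i \<bullet> x))\<^sup>2"
      by (auto simp: power_mult_distrib intro!: mult_right_mono power_mono)
  qed
  also have "\<dots> = (s k)\<^sup>2 * (\<Sum>i\<in>T. (v i \<bullet> x)\<^sup>2)"
    by (simp add: power_mult_distrib sum_distrib_left)
  also have "\<dots> \<le> (s k)\<^sup>2 * (norm x)\<^sup>2"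
    by (intro mult_left_mono Bessel_inequality orthonormal_on_subset[OF ov sub(1)] sub(2)) simp
  also have "\<dots> = (s k * norm x)\<^sup>2"
    by (simp add: power_mult_distrib)
  finally show ?thesis
    by (rule power2_le_imp_le) (simp add: s0[OF k])
qed

text \<open>The Eckart-Young-Mirsky lower bound: a matrix of rank less than \<open>k\<close> annihilates a nonzero vector in the
  span of the first \<open>k\<close> right singular vectors of \<open>X\<close>, a space on which \<open>X\<close> stretches by at
  least \<open>s k\<close>.\<close>

lemma svd_le_of_low_rank_approx:
  fixes X Z :: "real^'n^'m"
  assumes svd: "is_svd X s u v" and k: "k \<in> {1..min CARD('m) CARD('n)}"
    and Z: "rank Z < k" and B: "\<And>x. norm ((X - Z) *v x) \<le> B * norm x"
  shows "s k \<le> B"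
proof -
  have ov: "orthonormal_on {1..k} v"
    using svd k unfolding is_svd_iff by (auto intro: orthonormal_on_subset)
  obtain x where x: "x \<in> span (v ` {1..k})" "x \<noteq> 0" "Z *v x = 0"
    using low_rank_kernel_vector[OF ov, of Z] Z by auto
  have "s k * norm x \<le> norm (X *v x)"
    by (rule svd_lower_bound[OF svd k x(1)])
  also have "\<dots> = norm ((X - Z) *v x)"
    by (simp add: matrix_vector_mult_diff_rdistrib x(3))
  also have "\<dots> \<le> B * norm x"
    by (rule B)
  finally show ?thesis
    using x(2) by simp
qed

text \<open>Truncating one decomposition before its \<open>k\<close>-th term gives an approximation of rank less than \<open>k\<close>
  with error at most the \<open>k\<close>-th value, which therefore bounds the \<open>k\<close>-th value of every other
  decomposition. By symmetry \<^const>\<open>singular_value\<close> is well defined.\<close>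

lemma svd_le_svd:
  fixes X :: "real^'n^'m"
  assumes "is_svd X s u v" "is_svd X s' u' v'" and k: "k \<in> {1..min CARD('m) CARD('n)}"
  shows "s k \<le> s' k"
proof (rule svd_le_of_low_rank_approx[OF assms(1) k])
  have "orthonormal_on {1..<k} u'" "orthonormal_on {1..<k} v'"
    using assms(2) k unfolding is_svd_iff by (auto intro: orthonormal_on_subset)
  then have "rank (outer_sum {1..<k} s' u' v') = card {i\<in>{1..<k}. s' i \<noteq> 0}"
    by (rule rank_outer_sum) simp
  also have "\<dots> \<le> card {1..<k}"
    by (intro card_mono) auto
  also have "\<dots> < k" using k by simp
  finally show "rank (outer_sum {1..<k} s' u' v') < k" .
  show "norm ((X - outer_sum {1..<k} s' u' v') *v x) \<le> s' k * norm x" for x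
    by (rule svd_tail_bound[OF assms(2) k])
qed

lemma singular_value_eq:
  fixes X :: "real^'n^'m"
  assumes "is_svd X s u v" "k \<in> {1..min CARD('m) CARD('n)}"
  shows "singular_value k X = s k"
  unfolding singular_value_def
proof (rule the_equality)
  show "\<exists>s' u v. is_svd X s' u v \<and> s k = s' k"
    using assms(1) by blast
  show "t = s k" if "\<exists>s u v. is_svd X s u v \<and> t = s k" for t
    using that svd_le_svd assms by (metis order_antisym)
qed

lemma singular_value_le_norm_diff:
  fixes X Z :: "real^'n^'m"
  assumes "k \<in> {1..min CARD('m) CARD('n)}" "rank Z < k"
  shows "singular_value k X \<le> norm (X - Z)"
proof -
  obtain s u v where svd: "is_svd X s u v"
    using svd_exists by blast
  show ?thesis
    unfolding singular_value_eq[OF svd assms(1)]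
    by (rule svd_le_of_low_rank_approx[OF svd assms norm_matrix_vector_mult_le])
qed

lemma rank_svd:
  fixes X :: "real^'n^'m"
  assumes "is_svd X s u v"
  shows "rank X = card {i\<in>{1..min CARD('m) CARD('n)}. s i \<noteq> 0}"
  using assms rank_outer_sum[of "{1..min CARD('m) CARD('n)}" u v s] unfolding is_svd_iff by auto

lemma singular_value_pos:
  fixes X :: "real^'n^'m"
  assumes k: "k \<in> {1..min CARD('m) CARD('n)}" and rank: "k \<le> rank X"
  shows "0 < singular_value k X"
proof (rule ccontr)
  assume neg: "\<not> 0 < singular_value k X"
  obtain s u v where svd: "is_svd X s u v"
    using svd_exists by blast
  have "s i = 0" if "i \<in> {1..min CARD('m) CARD('n)}" "k \<le> i" for i
  proof -
    have "0 \<le> s i" "s i \<le> s k"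
      using svd k that unfolding is_svd_iff monotone_on_def by auto
    then show ?thesis
      using neg singular_value_eq[OF svd k] by simp
  qed
  then have "{i\<in>{1..min CARD('m) CARD('n)}. s i \<noteq> 0} \<subseteq> {1..<k}"
    by force
  then have "rank X \<le> card {1..<k}"
    unfolding rank_svd[OF svd] by (intro card_mono) auto
  then show False
    using rank k by auto
qed

text \<open>The approximation omits the term of the smallest nonzero singular value.\<close>

lemma approx_of_rank_minus_one:
  fixes X :: "real^'n^'m"
  assumes q: "0 < rank X"
  obtains W where "rank W = rank X - 1" "norm (X - W) \<le> singular_value (rank X) X"
proof -
  define q where "q = rank X"
  define I where "I = {1..min CARD('m) CARD('n)}"
  have qI: "q \<in> {1..min CARD('m) CARD('n)}"
    using q rank_bound[of X] by (auto simp: q_def)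
  obtain s u v where svd: "is_svd X s u v"
    using svd_exists by blast
  have s0: "\<And>i. i \<in> I \<Longrightarrow> 0 \<le> s i"
    and ou: "orthonormal_on I u" and ov: "orthonormal_on I v" and X: "X = outer_sum I s u v"
    using svd unfolding is_svd_iff I_def by auto
  have sq: "singular_value q X = s q" "0 < s q"
    using singular_value_eq[OF svd qI] singular_value_pos[OF qI, of X] by (auto simp: q_def)
  have qI': "q \<in> I" "finite I" using qI by (auto simp: I_def)
  define W where "W = outer_sum I (s(q := 0)) u v"
  have "rank W = card {i\<in>I. (s(q := 0)) i \<noteq> 0}"
    unfolding W_def by (rule rank_outer_sum[OF ou ov qI'(2)])
  also have "{i\<in>I. (s(q := 0)) i \<noteq> 0} = {i\<in>I. s i \<noteq> 0} - {q}"
    by auto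
  also have "card \<dots> = rank X - 1"
    using qI' sq unfolding rank_svd[OF svd] I_def[symmetric] by (subst card_Diff_singleton) auto
  finally have rW: "rank W = rank X - 1" .
  have "X - W = outer_sum I (\<lambda>i. s i - (s(q := 0)) i) u v"
    unfolding X W_def by (simp add: scaleR_diff_left sum_subtractf)
  also have "\<dots> = (\<Sum>i\<in>I. if i = q then s q *\<^sub>R outer (u q) (v q) else 0)"
    by (intro sum.cong) auto
  also have "\<dots> = s q *\<^sub>R outer (u q) (v q)"
    using qI' by simp
  finally have "norm (X - W) = s q"
    using orthonormal_on_norm[OF ou qI'(1)] orthonormal_on_norm[OF ov qI'(1)] sq
    by (simp add: norm_outer)
  then show thesis
    using that[OF rW] sq by (simp add: q_def)
qed

text \<open>Around a matrix \<open>X\<close> of rank greater than \<open>q\<close>, the ball whose radius is the singular value of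
  index \<open>q + 1\<close> contains no matrix of rank at most \<open>q\<close>.\<close>

lemma closed_rank_le: "closed (rank_le q :: (real^'n^'m) set)"
proof (cases "q < min CARD('m) CARD('n)")
  case False
  then have "rank X \<le> q" for X :: "real^'n^'m"
    using rank_bound[of X] by auto
  then have "rank_le q = (UNIV :: (real^'n^'m) set)"
    by (simp add: rank_le_def)
  then show ?thesis by simp
next
  case True
  then have q: "Suc q \<in> {1..min CARD('m) CARD('n)}" by auto
  have "open (- rank_le q :: (real^'n^'m) set)"
    unfolding open_contains_ball
  proof
    fix X :: "real^'n^'m" assume "X \<in> - rank_le q"
    then have "0 < singular_value (Suc q) X"
      by (intro singular_value_pos[OF q]) (simp add: rank_le_def)
    moreover have "ball X (singular_value (Suc q) X) \<subseteq> - rank_le q"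
    proof
      fix Y assume Y: "Y \<in> ball X (singular_value (Suc q) X)"
      have "\<not> rank Y < Suc q"
        using singular_value_le_norm_diff[OF q, of Y X] Y by (auto simp: dist_norm)
      then show "Y \<in> - rank_le q"
        by (simp add: rank_le_def)
    qed
    ultimately show "\<exists>e>0. ball X e \<subseteq> - rank_le q" by blast
  qed
  then show ?thesis by (simp add: closed_def)
qed

section \<open>Tangent cones and projections onto them\<close>

text \<open>In this form, free of sequences, closedness of the tangent cone is a triangle inequality.\<close>

lemma tangent_cone_iff:
  "z \<in> tangent_cone S x \<longleftrightarrow>
     (\<forall>e>0. \<exists>y\<in>S. \<exists>t>0. dist y x < e \<and> dist ((y - x) /\<^sub>R t) z < e)"
proof
  assume "z \<in> tangent_cone S x"
  then obtain xs t where xs: "\<And>i::nat. xs i \<in> S" "xs \<longlonglongrightarrow> x" "\<And>i. 0 < (t i :: real)"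
    "(\<lambda>i. (xs i - x) /\<^sub>R t i) \<longlonglongrightarrow> z"
    by (auto simp: tangent_cone_def)
  show "\<forall>e>0. \<exists>y\<in>S. \<exists>t>0. dist y x < e \<and> dist ((y - x) /\<^sub>R t) z < e"
  proof (intro allI impI)
    fix e :: real assume "e > 0"
    then have "\<forall>\<^sub>F i in sequentially. dist (xs i) x < e \<and> dist ((xs i - x) /\<^sub>R t i) z < e"
      using xs by (intro eventually_conj tendstoD)
    then obtain i where "dist (xs i) x < e \<and> dist ((xs i - x) /\<^sub>R t i) z < e"
      by (auto simp: eventually_sequentially)
    then show "\<exists>y\<in>S. \<exists>t>0. dist y x < e \<and> dist ((y - x) /\<^sub>R t) z < e"
      using xs by blast
  qed
next
  assume *: "\<forall>e>0. \<exists>y\<in>S. \<exists>t>0. dist y x < e \<and> dist ((y - x) /\<^sub>R t) z < e"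
  have "\<forall>i. \<exists>y t. y \<in> S \<and> t > 0 \<and> dist y x < inverse (Suc i) \<and> dist ((y - x) /\<^sub>R t) z < inverse (Suc i)"
    using * by (metis inverse_positive_iff_positive of_nat_0_less_iff zero_less_Suc)
  then obtain xs t where xs: "\<And>i. xs i \<in> S" "\<And>i. t i > 0" "\<And>i. dist (xs i) x < inverse (Suc i)"
    "\<And>i. dist ((xs i - x) /\<^sub>R t i) z < inverse (Suc i)"
    by metis
  have "xs \<longlonglongrightarrow> x" "(\<lambda>i. (xs i - x) /\<^sub>R t i) \<longlonglongrightarrow> z"
    using xs(3,4) by (auto intro!: metric_tendsto_imp_tendsto[OF LIMSEQ_inverse_real_of_nat]
        always_eventually less_imp_le simp: dist_real_def)
  then show "z \<in> tangent_cone S x"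
    unfolding tangent_cone_def using xs by blast
qed

lemma closed_tangent_cone: "closed (tangent_cone S x)"
  unfolding closed_sequential_limits
proof (intro allI impI)
  fix zs z assume "(\<forall>n. zs n \<in> tangent_cone S x) \<and> zs \<longlonglongrightarrow> z"
  then have zs: "\<And>n. zs n \<in> tangent_cone S x" "zs \<longlonglongrightarrow> z" by auto
  show "z \<in> tangent_cone S x"
    unfolding tangent_cone_iff
  proof (intro allI impI)
    fix e :: real assume e: "e > 0"
    then obtain n where n: "dist (zs n) z < e / 2"
      using tendstoD[OF zs(2), of "e / 2"] by (auto simp: eventually_sequentially)
    obtain y t where y: "y \<in> S" "t > 0" "dist y x < e / 2" "dist ((y - x) /\<^sub>R t) (zs n) < e / 2"
      using zs(1)[of n] e unfolding tangent_cone_iff by (meson half_gt_zero)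
    have "dist ((y - x) /\<^sub>R t) z < e"
      using dist_triangle_half_l[OF y(4)] n by (metis dist_commute)
    then show "\<exists>y\<in>S. \<exists>t>0. dist y x < e \<and> dist ((y - x) /\<^sub>R t) z < e"
      using y e by (intro bexI[of _ y] exI[of _ t]) auto
  qed
qed

lemma tangent_cone_zero: "x \<in> S \<Longrightarrow> 0 \<in> tangent_cone S x"
  unfolding tangent_cone_iff by (auto intro!: bexI[of _ x] exI[of _ 1])

lemma tangent_cone_scale:
  assumes "z \<in> tangent_cone S x" "0 < c"
  shows "c *\<^sub>R z \<in> tangent_cone S x"
proof -
  obtain xs t where xs: "\<And>i::nat. xs i \<in> S" "xs \<longlonglongrightarrow> x" "\<And>i. 0 < (t i :: real)"
    "(\<lambda>i. (xs i - x) /\<^sub>R t i) \<longlonglongrightarrow> z"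
    using assms by (auto simp: tangent_cone_def)
  have "(\<lambda>i. c *\<^sub>R ((xs i - x) /\<^sub>R t i)) \<longlonglongrightarrow> c *\<^sub>R z"
    by (intro tendsto_intros xs)
  then have "(\<lambda>i. (xs i - x) /\<^sub>R (t i / c)) \<longlonglongrightarrow> c *\<^sub>R z"
    by (simp add: field_simps)
  moreover have "\<And>i. 0 < t i / c"
    using xs(3) assms(2) by simp
  ultimately show ?thesis
    unfolding tangent_cone_def using xs(1,2)
    by (intro CollectI exI[of _ xs] exI[of _ "\<lambda>i. t i / c"]) auto
qed

lemma ray_in_tangent_cone:
  assumes "\<And>t. 0 < t \<Longrightarrow> x + t *\<^sub>R z \<in> S"
  shows "z \<in> tangent_cone S x"
  unfolding tangent_cone_def
proof (intro CollectI exI conjI allI)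
  let ?t = "\<lambda>i. inverse (real (Suc i))"
  show "x + ?t i *\<^sub>R z \<in> S" "0 < ?t i" for i
    by (intro assms) simp_all
  have "(\<lambda>i. x + ?t i *\<^sub>R z) \<longlonglongrightarrow> x + 0 *\<^sub>R z"
    by (intro tendsto_intros LIMSEQ_inverse_real_of_nat)
  then show "(\<lambda>i. x + ?t i *\<^sub>R z) \<longlonglongrightarrow> x" by simp
  show "(\<lambda>i. (x + ?t i *\<^sub>R z - x) /\<^sub>R ?t i) \<longlonglongrightarrow> z"
    by (simp del: of_nat_Suc)
qed

text \<open>A projection \<open>G\<close> of \<open>g\<close> onto a cone is also optimal among all positive multiples of \<open>G\<close> and
  of any other \<open>Z\<close> in the cone; minimising over the multiples gives the identity and the inequality. Together
  they say that \<open>norm G\<close> is the largest value of \<open>g \<bullet> Z\<close> over cone vectors \<open>Z\<close> of norm at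
  most one.\<close>

lemma proj_cone:
  fixes g :: "'a::real_inner"
  assumes G: "G \<in> proj_set T g" and cone: "\<And>Z t. Z \<in> T \<Longrightarrow> 0 < t \<Longrightarrow> t *\<^sub>R Z \<in> T"
    and zero: "0 \<in> T"
  shows "g \<bullet> G = (norm G)\<^sup>2" and "Z \<in> T \<Longrightarrow> g \<bullet> Z \<le> norm G * norm Z"
proof -
  have GT: "G \<in> T" and min: "\<And>Z. Z \<in> T \<Longrightarrow> dist g G \<le> dist g Z"
    using G by (auto simp: proj_set_def is_arg_min_linorder)
  have le: "(norm G)\<^sup>2 - 2 * (g \<bullet> G) \<le> (norm Z)\<^sup>2 - 2 * (g \<bullet> Z)" if "Z \<in> T" for Z
  proof -
    have "(norm (g - G))\<^sup>2 \<le> (norm (g - Z))\<^sup>2"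
      using min[OF that] by (intro power_mono) (simp_all add: dist_norm)
    then show ?thesis
      by (simp add: power2_norm_eq_inner inner_diff_left inner_diff_right inner_commute)
  qed
  \<comment> \<open>The multiple of \<open>Z\<close> nearest to \<open>g\<close> lies in the cone, hence is no nearer than \<open>G\<close>.\<close>
  have opt: "(g \<bullet> Z)\<^sup>2 / (norm Z)\<^sup>2 \<le> 2 * (g \<bullet> G) - (norm G)\<^sup>2" if "Z \<in> T" "0 < g \<bullet> Z" for Z
  proof -
    have Z: "norm Z > 0" using that(2) by auto
    define t where "t = (g \<bullet> Z) / (norm Z)\<^sup>2"
    have "t *\<^sub>R Z \<in> T"
      using that Z by (intro cone) (auto simp: t_def)
    from le[OF this] have "(norm G)\<^sup>2 - 2 * (g \<bullet> G) \<le> t\<^sup>2 * (norm Z)\<^sup>2 - 2 * (t * (g \<bullet> Z))"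
      by (simp add: power_mult_distrib)
    also have "\<dots> = - ((g \<bullet> Z)\<^sup>2 / (norm Z)\<^sup>2)"
      using Z by (simp add: t_def power2_eq_square field_simps)
    finally show ?thesis by simp
  qed
  show eq: "g \<bullet> G = (norm G)\<^sup>2"
  proof (cases "G = 0")
    case False
    then have pos: "0 < (norm G)\<^sup>2" by simp
    then have "0 < g \<bullet> G"
    proof -
      have "(norm G)\<^sup>2 - 2 * (g \<bullet> G) \<le> 0"
        using le[OF zero] by simp
      then show ?thesis using pos by linarith
    qed
    from opt[OF GT this] have "(g \<bullet> G)\<^sup>2 \<le> (2 * (g \<bullet> G) - (norm G)\<^sup>2) * (norm G)\<^sup>2"
      using pos by (simp add: pos_divide_le_eq)
    then have "(g \<bullet> G - (norm G)\<^sup>2)\<^sup>2 \<le> 0"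
      by (simp add: power2_eq_square algebra_simps)
    then show ?thesis by simp
  qed simp
  show "g \<bullet> Z \<le> norm G * norm Z" if "Z \<in> T"
  proof (cases "0 < g \<bullet> Z")
    case True
    then have Z: "norm Z > 0" by auto
    have "(g \<bullet> Z)\<^sup>2 \<le> (norm G * norm Z)\<^sup>2"
      using opt[OF that True] eq Z by (simp add: pos_divide_le_eq power_mult_distrib)
    then show ?thesis
      by (rule power2_le_imp_le) simp
  next
    case False
    then show ?thesis
      by (meson mult_nonneg_nonneg norm_ge_zero not_less order_trans)
  qed
qed

section \<open>The stationarity measure\<close>

text \<open>The definite description in \<^const>\<open>stat_measure\<close> denotes: a projection exists because the tangent
  cone is closed, and two projections \<open>H\<close>, \<open>H'\<close> of the same point \<open>g\<close> satisfy
  \<open>(norm H)\<^sup>2 = g \<bullet> H \<le> norm H' * norm H\<close>.\<close>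

lemma stat_measure_props:
  fixes f :: "real^'n^'m \<Rightarrow> real"
  assumes X: "X \<in> rank_le q"
  obtains G where "G \<in> tangent_cone (rank_le q) X" "norm G = stat_measure f q X"
    "- grad f X \<bullet> G = (stat_measure f q X)\<^sup>2"
    "\<And>Z. Z \<in> tangent_cone (rank_le q) X \<Longrightarrow> - grad f X \<bullet> Z \<le> stat_measure f q X * norm Z"
proof -
  let ?T = "tangent_cone (rank_le q) X" and ?g = "- grad f X"
  have zero: "0 \<in> ?T"
    by (rule tangent_cone_zero[OF X])
  obtain G where "G \<in> ?T" "\<And>Z. Z \<in> ?T \<Longrightarrow> dist ?g G \<le> dist ?g Z"
    using distance_attains_inf[OF closed_tangent_cone, of "rank_le q" X ?g] zero by auto
  then have G: "G \<in> proj_set ?T ?g" and GT: "G \<in> ?T"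
    by (auto simp: proj_set_def is_arg_min_linorder)
  have "stat_measure f q X = norm G"
    unfolding stat_measure_def
  proof (rule the_equality)
    show "\<exists>H\<in>proj_set ?T ?g. norm G = norm H"
      using G by blast
    have le: "norm H \<le> norm H'" if "H \<in> proj_set ?T ?g" "H' \<in> proj_set ?T ?g" for H H'
    proof -
      have "H \<in> ?T" using that(1) by (simp add: proj_set_def is_arg_min_linorder)
      then have "(norm H)\<^sup>2 \<le> norm H' * norm H"
        using proj_cone[OF that(1) tangent_cone_scale zero]
          proj_cone[OF that(2) tangent_cone_scale zero] by metis
      then show ?thesis
        by (cases "H = 0") (simp_all add: power2_eq_square)
    qed
    show "d = norm G" if "\<exists>H\<in>proj_set ?T ?g. d = norm H" for d
      using that le[OF _ G] le[OF G] by (auto intro: order_antisym)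
  qed
  then show thesis
    using that[of G] GT proj_cone[OF G tangent_cone_scale zero] by auto
qed

lemma stat_measure_bound:
  fixes f :: "real^'n^'m \<Rightarrow> real"
  assumes "X \<in> rank_le q" "Z \<in> tangent_cone (rank_le q) X" "- Z \<in> tangent_cone (rank_le q) X"
  shows "\<bar>grad f X \<bullet> Z\<bar> \<le> stat_measure f q X * norm Z"
proof -
  have le: "- grad f X \<bullet> D \<le> stat_measure f q X * norm D" if "D \<in> tangent_cone (rank_le q) X" for D
    using stat_measure_props[OF assms(1), of f] that by blast
  show ?thesis
    using le[OF assms(2)] le[OF assms(3)] by (simp add: abs_le_iff)
qed

lemma stat_measure_nonneg: "X \<in> rank_le q \<Longrightarrow> 0 \<le> stat_measure f q X"
  using stat_measure_props by (metis norm_ge_zero)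

lemma b_stationary_iff:
  assumes "X \<in> rank_le q"
  shows "b_stationary f q X \<longleftrightarrow> stat_measure f q X = 0"
proof -
  obtain G where G: "G \<in> tangent_cone (rank_le q) X" "- grad f X \<bullet> G = (stat_measure f q X)\<^sup>2"
    and le: "\<And>Z. Z \<in> tangent_cone (rank_le q) X \<Longrightarrow> - grad f X \<bullet> Z \<le> stat_measure f q X * norm Z"
    using stat_measure_props[OF assms] by metis
  show ?thesis
  proof
    assume "b_stationary f q X"
    then have "0 \<le> grad f X \<bullet> G"
      using G(1) by (simp add: b_stationary_def)
    then have "- grad f X \<bullet> G \<le> 0"
      by simp
    then have "(stat_measure f q X)\<^sup>2 \<le> 0"
      by (simp only: G(2))
    then show "stat_measure f q X = 0" by simp
  next
    assume "stat_measure f q X = 0"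
    then show "b_stationary f q X"
      using le assms by (auto simp: b_stationary_def)
  qed
qed

section \<open>Tangent directions to the variety of low-rank matrices\<close>

lemma rank_add_outer_le:
  fixes X :: "real^'n^'m"
  shows "rank (X + outer p z) \<le> Suc (rank X)"
proof -
  have "range ((*v) (X + outer p z)) \<subseteq> span (insert p (range ((*v) X)))"
    by (force simp: matrix_vector_mult_add_rdistrib outer_mult intro: span_add span_scale span_base)
  then have "rank (X + outer p z) \<le> dim (insert p (range ((*v) X)))"
    unfolding rank_dim_range by (metis dim_span dim_subset)
  also have "\<dots> \<le> Suc (rank X)"
    unfolding rank_dim_range by (simp add: dim_insert)
  finally show ?thesis .
qed

lemma outer_tangent_of_deficient_rank:
  fixes X :: "real^'n^'m"
  assumes "rank X < q"
  shows "outer p z \<in> tangent_cone (rank_le q) X"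
proof (rule ray_in_tangent_cone)
  fix t :: real
  show "X + t *\<^sub>R outer p z \<in> rank_le q"
    using rank_add_outer_le[of X "t *\<^sub>R p" z] assms by (simp add: rank_le_def outer_scaleR_left)
qed

text \<open>Multiplication by a matrix \<open>I + t y z\<^sup>T\<close> does not raise the rank, so it moves \<open>X\<close> along a
  line inside the variety. These directions depend continuously on \<open>X\<close>, whatever its rank, which is
  what allows passing to limits below.\<close>

lemma outer_column_space_tangent:
  fixes X :: "real^'n^'m"
  assumes "X \<in> rank_le q"
  shows "outer (X *v y) z \<in> tangent_cone (rank_le q) X"
proof (rule ray_in_tangent_cone)
  fix t :: real
  have "X + t *\<^sub>R outer (X *v y) z = X ** (mat 1 + t *\<^sub>R outer y z)"
    by (simp add: matrix_eq matrix_vector_mult_add_rdistrib outer_mult matrix_vector_right_distrib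
        matrix_vector_mult_scaleR flip: matrix_vector_mul_assoc scaleR_matrix_vector_assoc)
  then show "X + t *\<^sub>R outer (X *v y) z \<in> rank_le q"
    using rank_mul_le_left[of X] assms by (auto simp: rank_le_def intro: order_trans)
qed

lemma outer_row_space_tangent:
  fixes X :: "real^'n^'m"
  assumes "X \<in> rank_le q"
  shows "outer p (transpose X *v w) \<in> tangent_cone (rank_le q) X"
proof (rule ray_in_tangent_cone)
  fix t :: real
  have "(transpose X *v w) \<bullet> x = w \<bullet> (X *v x)" for x
    using inner_matrix_vector_mult[of X x w] by (simp add: inner_commute)
  then have "X + t *\<^sub>R outer p (transpose X *v w) = (mat 1 + t *\<^sub>R outer p w) ** X"
    by (simp add: matrix_eq matrix_vector_mult_add_rdistrib outer_mult
        flip: matrix_vector_mul_assoc scaleR_matrix_vector_assoc)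
  then show "X + t *\<^sub>R outer p (transpose X *v w) \<in> rank_le q"
    using rank_mul_le_right[of "mat 1 + t *\<^sub>R outer p w" X] assms by (simp add: rank_le_def)
qed

text \<open>The variety of matrices of rank at most \<open>rank Z\<close> leaves its tangent space at \<open>Z\<close> only to second
  order. Near \<open>Z\<close> the matrix \<open>Y\<close> is injective on the row space of \<open>Z\<close>, so by the rank bound
  its range is the image of that space; hence \<open>Y b = Y w\<close> with \<open>w\<close> in the row space, and \<open>w\<close>
  is small because \<open>Y b = (Y - Z) b\<close> is. As \<open>a\<close> annihilates the range of \<open>Z\<close>, the quantity
  in question equals \<open>a \<bullet> ((Y - Z) w)\<close>, a product of two small factors.\<close>

lemma normal_block_quadratic_bound:
  fixes Y Z :: "real^'n^'m"
  assumes Y: "rank Y \<le> rank Z" and pos: "0 < rank Z"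
    and close: "norm (Y - Z) < singular_value (rank Z) Z"
    and a: "transpose Z *v a = 0" and b: "Z *v b = 0"
  shows "\<bar>a \<bullet> ((Y - Z) *v b)\<bar>
    \<le> norm a * (norm (Y - Z) * (norm (Y - Z) * norm b / (singular_value (rank Z) Z - norm (Y - Z))))"
proof -
  define q where "q = rank Z"
  define d where "d = norm (Y - Z)"
  have q: "q \<in> {1..min CARD('m) CARD('n)}"
    using pos rank_bound[of Z] by (auto simp: q_def)
  obtain s u v where svd: "is_svd Z s u v"
    using svd_exists by blast
  note sq = singular_value_eq[OF svd q]
  have gap: "0 < s q - d"
    using close sq by (simp add: q_def d_def)
  let ?V = "span (v ` {1..q})"
  have ov: "orthonormal_on {1..q} v"
    using svd q unfolding is_svd_iff by (auto intro: orthonormal_on_subset)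
  have lower: "(s q - d) * norm x \<le> norm (Y *v x)" if "x \<in> ?V" for x
  proof -
    have "s q * norm x \<le> norm (Z *v x)"
      by (rule svd_lower_bound[OF svd q that])
    also have "Z *v x = Y *v x - (Y - Z) *v x"
      by (simp add: matrix_vector_mult_diff_rdistrib)
    also have "norm \<dots> \<le> norm (Y *v x) + d * norm x"
      unfolding d_def
      by (intro order_trans[OF norm_triangle_ineq4] add_left_mono norm_matrix_vector_mult_le)
    finally show ?thesis by (simp add: algebra_simps)
  qed
  have "inj_on ((*v) Y) (span ?V)"
  proof (rule inj_onI)
    fix x y assume xy: "x \<in> span ?V" "y \<in> span ?V" "Y *v x = Y *v y"
    have "(s q - d) * norm (x - y) \<le> norm (Y *v (x - y))"
      by (rule lower) (use xy in \<open>simp only: span_span span_diff\<close>)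
    then show "x = y"
      using gap xy(3) by (simp add: matrix_vector_mult_diff_distrib mult_le_0_iff)
  qed
  then have "dim ((*v) Y ` ?V) = dim ?V"
    by (intro dim_image_eq matrix_vector_mul_linear)
  then have "dim (range ((*v) Y)) \<le> dim ((*v) Y ` ?V)"
    using Y dim_orthonormal_span[OF ov] by (simp add: rank_dim_range q_def)
  then have "(*v) Y ` ?V = range ((*v) Y)"
    by (intro subspace_dim_equal linear_subspace_image matrix_vector_mul_linear subspace_span
        subspace_UNIV) auto
  then obtain w where w: "w \<in> ?V" "Y *v b = Y *v w"
    by (metis imageE rangeI)
  have "(s q - d) * norm w \<le> norm ((Y - Z) *v b)"
    using lower[OF w(1)] w(2) b by (simp add: matrix_vector_mult_diff_rdistrib)
  also have "\<dots> \<le> d * norm b"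
    unfolding d_def by (rule norm_matrix_vector_mult_le)
  finally have wb: "norm w \<le> d * norm b / (s q - d)"
    using gap by (simp add: pos_le_divide_eq mult.commute)
  have "a \<bullet> (Z *v x) = 0" for x
    using inner_matrix_vector_mult[of Z x a] a by (simp add: inner_commute)
  then have "a \<bullet> ((Y - Z) *v b) = a \<bullet> ((Y - Z) *v w)"
    using w(2) by (simp add: matrix_vector_mult_diff_rdistrib inner_diff_right)
  also have "\<bar>\<dots>\<bar> \<le> norm a * norm ((Y - Z) *v w)"
    by (rule Cauchy_Schwarz_ineq2)
  also have "\<dots> \<le> norm a * (d * norm w)"
    unfolding d_def by (intro mult_left_mono norm_matrix_vector_mult_le) simp
  also have "\<dots> \<le> norm a * (d * (d * norm b / (s q - d)))"
    using wb by (intro mult_left_mono) (auto simp: d_def)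
  finally show ?thesis
    using sq by (simp add: d_def q_def)
qed

text \<open>Divided by the step \<open>t\<close>, the quadratic bound still contains the factor \<open>norm (Y - Z)\<close>, which
  tends to \<open>0\<close>.\<close>

lemma tangent_cone_normal_block:
  fixes Z H :: "real^'n^'m"
  assumes pos: "0 < rank Z" and H: "H \<in> tangent_cone (rank_le (rank Z)) Z"
    and a: "transpose Z *v a = 0" and b: "Z *v b = 0"
  shows "a \<bullet> (H *v b) = 0"
proof -
  let ?s = "singular_value (rank Z) Z"
  have s: "0 < ?s"
    using pos rank_bound[of Z] by (intro singular_value_pos) auto
  obtain Ys t where Ys: "\<And>i::nat. Ys i \<in> rank_le (rank Z)" "Ys \<longlonglongrightarrow> Z" "\<And>i. 0 < (t i :: real)"
    and lim: "(\<lambda>i. (Ys i - Z) /\<^sub>R t i) \<longlonglongrightarrow> H"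
    using H by (auto simp: tangent_cone_def)
  let ?H = "\<lambda>i. (Ys i - Z) /\<^sub>R t i" and ?d = "\<lambda>i. norm (Ys i - Z)"
  have d0: "?d \<longlonglongrightarrow> 0"
    using Ys(2) by (simp add: LIM_zero tendsto_norm_zero)
  have "(\<lambda>i. norm a * (norm (?H i) * (?d i * norm b / (?s - ?d i))))
      \<longlonglongrightarrow> norm a * (norm H * (0 * norm b / (?s - 0)))"
    using s by (intro tendsto_intros lim d0) auto
  then have up: "(\<lambda>i. norm a * (norm (?H i) * (?d i * norm b / (?s - ?d i)))) \<longlonglongrightarrow> 0"
    by simp
  have "\<forall>\<^sub>F i in sequentially. ?d i < ?s"
    using order_tendstoD(2)[OF d0 s] .
  then have "\<forall>\<^sub>F i in sequentially.
      norm (a \<bullet> (?H i *v b)) \<le> norm a * (norm (?H i) * (?d i * norm b / (?s - ?d i)))"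
  proof eventually_elim
    case (elim i)
    have "\<bar>a \<bullet> ((Ys i - Z) *v b)\<bar> \<le> norm a * (?d i * (?d i * norm b / (?s - ?d i)))"
      using Ys(1)[of i] elim by (intro normal_block_quadratic_bound pos a b) (auto simp: rank_le_def)
    then have "\<bar>a \<bullet> ((Ys i - Z) *v b)\<bar> / t i \<le> norm a * (?d i * (?d i * norm b / (?s - ?d i))) / t i"
      using Ys(3)[of i] by (intro divide_right_mono) auto
    then show ?case
      using Ys(3)[of i]
      by (simp add: abs_mult divide_inverse mult_ac flip: scaleR_matrix_vector_assoc)
  qed
  then have "(\<lambda>i. a \<bullet> (?H i *v b)) \<longlonglongrightarrow> 0"
    by (rule Lim_null_comparison[OF _ up])
  moreover have "(\<lambda>i. ?H i \<bullet> outer a b) \<longlonglongrightarrow> H \<bullet> outer a b"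
    by (intro tendsto_intros lim)
  ultimately show ?thesis
    by (simp only: inner_outer) (rule LIMSEQ_unique)
qed

text \<open>The two orthogonality assumptions put the singular vectors \<open>u\<close>, \<open>v\<close> of \<open>g\<close> belonging to a
  nonzero singular value into the kernels of \<open>Z\<^sup>T\<close> and \<open>Z\<close>. A tangent \<open>H\<close> has
  \<open>u \<bullet> (H v) = 0\<close> for such vectors, and \<open>g \<bullet> H\<close> is a combination of these numbers.\<close>

lemma inner_tangent_eq_0:
  fixes Z H g :: "real^'n^'m"
  assumes pos: "0 < rank Z" and H: "H \<in> tangent_cone (rank_le (rank Z)) Z"
    and col: "\<And>y z. g \<bullet> outer (Z *v y) z = 0"
    and row: "\<And>p w. g \<bullet> outer p (transpose Z *v w) = 0"
  shows "g \<bullet> H = 0"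
proof -
  define I where "I = {1..min CARD('m) CARD('n)}"
  obtain s u v where svd: "is_svd g s u v"
    using svd_exists by blast
  then have ou: "orthonormal_on I u" and ov: "orthonormal_on I v" and g: "g = outer_sum I s u v"
    unfolding is_svd_iff I_def by auto
  have fin: "finite I" by (simp add: I_def)
  have gv: "p \<bullet> (g *v x) = (\<Sum>i\<in>I. s i * (v i \<bullet> x) * (p \<bullet> u i))" for p x
    unfolding g outer_sum_mult by (simp add: inner_sum_right)
  have "s i * (u i \<bullet> (H *v v i)) = 0" if i: "i \<in> I" for i
  proof (cases "s i = 0")
    case False
    have "s i * ((Z *v y) \<bullet> u i) = 0" for y
    proof -
      have "(Z *v y) \<bullet> (g *v v i) = (\<Sum>j\<in>I. if j = i then s i * ((Z *v y) \<bullet> u i) else 0)"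
        unfolding gv using i ov by (intro sum.cong) (auto simp: orthonormal_on_def)
      then show ?thesis
        using col[of y "v i"] i fin by (simp add: inner_outer)
    qed
    then have a: "transpose Z *v u i = 0"
      using False by (metis inner_eq_zero_iff inner_matrix_vector_mult mult_eq_0_iff)
    have "s i * (v i \<bullet> (transpose Z *v w)) = 0" for w
    proof -
      have "u i \<bullet> (g *v (transpose Z *v w)) = (\<Sum>j\<in>I. if j = i then s i * (v i \<bullet> (transpose Z *v w)) else 0)"
        unfolding gv using i ou by (intro sum.cong) (auto simp: orthonormal_on_def)
      then show ?thesis
        using row[of "u i" w] i fin by (simp add: inner_outer)
    qed
    then have b: "Z *v v i = 0"
      using False by (metis inner_eq_zero_iff inner_matrix_vector_mult mult_eq_0_iff)
    show ?thesis
      using tangent_cone_normal_block[OF pos H a b] by simp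
  qed simp
  moreover have "g \<bullet> H = (\<Sum>i\<in>I. s i * (u i \<bullet> (H *v v i)))"
    unfolding g by (simp add: inner_sum_left inner_commute[of "outer _ _" H] inner_outer)
  ultimately show ?thesis
    by (simp add: sum.neutral)
qed

section \<open>Limits of nearly stationary matrices\<close>

lemma tendsto_outer:
  assumes "(p \<longlongrightarrow> p') F" "(z \<longlongrightarrow> z') F"
  shows "((\<lambda>i. outer (p i) (z i)) \<longlongrightarrow> outer p' z') F"
  unfolding outer_def
  by (intro vec_tendstoI)
    (simp add: tendsto_mult[OF tendsto_vec_nth[OF assms(1)] tendsto_vec_nth[OF assms(2)]])

lemma tendsto_matrix_vector_mult:
  fixes A' :: "real^'n^'m"
  assumes "(A \<longlongrightarrow> A') F"
  shows "((\<lambda>i. A i *v y) \<longlongrightarrow> A' *v y) F"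
  unfolding matrix_vector_mult_def using assms
  by (intro vec_tendstoI) (auto intro!: tendsto_sum tendsto_mult tendsto_vec_nth)

lemma tendsto_transpose:
  fixes A' :: "real^'n^'m"
  assumes "(A \<longlongrightarrow> A') F"
  shows "((\<lambda>i. transpose (A i)) \<longlongrightarrow> transpose A') F"
  unfolding transpose_def using assms
  by (intro vec_tendstoI) (auto intro!: tendsto_vec_nth)

text \<open>At a limit of full rank \<open>q\<close> the stationarity measure is lower semicontinuous: the directions
  \<open>(W\<^sub>i y) z\<^sup>T\<close> and \<open>p (W\<^sub>i\<^sup>T w)\<^sup>T\<close> are tangent at \<open>W\<^sub>i\<close> together with their negatives, so the gradient
  becomes orthogonal to their limits, and those limits determine the tangent space at \<open>Z\<close>.\<close>

lemma b_stationary_limit_full_rank: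
  fixes f :: "real^'n^'m \<Rightarrow> real"
  assumes W: "\<And>i. W i \<in> rank_le q" "W \<longlonglongrightarrow> Z" and Z: "rank Z = q" "0 < q"
    and cont: "(\<lambda>i. grad f (W i)) \<longlonglongrightarrow> grad f Z"
    and s: "(\<lambda>i. stat_measure f q (W i)) \<longlonglongrightarrow> 0"
  shows "b_stationary f q Z"
proof -
  have lim0: "grad f Z \<bullet> D = 0"
    if "\<And>i. E i \<in> tangent_cone (rank_le q) (W i)" "\<And>i. - E i \<in> tangent_cone (rank_le q) (W i)"
      "E \<longlonglongrightarrow> D" for E D
  proof -
    have "(\<lambda>i. stat_measure f q (W i) * norm (E i)) \<longlonglongrightarrow> 0 * norm D"
      by (intro tendsto_intros s that)
    then have up: "(\<lambda>i. stat_measure f q (W i) * norm (E i)) \<longlonglongrightarrow> 0"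
      by simp
    have "(\<lambda>i. grad f (W i) \<bullet> E i) \<longlonglongrightarrow> 0"
      by (rule Lim_null_comparison[OF always_eventually up])
        (use stat_measure_bound[OF W(1) that(1,2)] in auto)
    moreover have "(\<lambda>i. grad f (W i) \<bullet> E i) \<longlonglongrightarrow> grad f Z \<bullet> D"
      by (intro tendsto_intros cont that)
    ultimately show ?thesis
      using LIMSEQ_unique by blast
  qed
  have neg: "- outer p z = outer (- p) z" for p :: "real^'m" and z :: "real^'n"
    using outer_scaleR_left[of "-1" p z] by simp
  have "grad f Z \<bullet> outer (Z *v y) z = 0" for y z
  proof (rule lim0)
    show "(\<lambda>i. outer (W i *v y) z) \<longlonglongrightarrow> outer (Z *v y) z"
      by (intro tendsto_outer tendsto_matrix_vector_mult W(2) tendsto_const)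
    have "- outer (W i *v y) z = outer (W i *v (- y)) z" for i
      by (simp add: neg linear_neg[OF matrix_vector_mul_linear])
    then show "- outer (W i *v y) z \<in> tangent_cone (rank_le q) (W i)" for i
      using outer_column_space_tangent[OF W(1)] by metis
  qed (rule outer_column_space_tangent[OF W(1)])
  moreover have "grad f Z \<bullet> outer p (transpose Z *v w) = 0" for p w
  proof (rule lim0)
    show "(\<lambda>i. outer p (transpose (W i) *v w)) \<longlonglongrightarrow> outer p (transpose Z *v w)"
      by (intro tendsto_outer tendsto_matrix_vector_mult tendsto_transpose W(2) tendsto_const)
    show "- outer p (transpose (W i) *v w) \<in> tangent_cone (rank_le q) (W i)" for i
      unfolding neg by (rule outer_row_space_tangent[OF W(1)])
  qed (rule outer_row_space_tangent[OF W(1)])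
  ultimately have "grad f Z \<bullet> H = 0" if "H \<in> tangent_cone (rank_le q) Z" for H
    using inner_tangent_eq_0[of Z H "grad f Z"] that Z by simp
  then show ?thesis
    using Z by (simp add: b_stationary_def rank_le_def)
qed

text \<open>At matrices of rank less than \<open>q\<close> every rank-one direction is tangent, so the stationarity measure
  controls each entry of the gradient.\<close>

lemma grad_eq_0_limit_deficient_rank:
  fixes f :: "real^'n^'m \<Rightarrow> real"
  assumes W: "\<And>i. rank (W i) < q"
    and cont: "(\<lambda>i. grad f (W i)) \<longlonglongrightarrow> grad f Z"
    and s: "(\<lambda>i. stat_measure f q (W i)) \<longlonglongrightarrow> 0"
  shows "grad f Z = 0"
proof -
  have "grad f Z $ a $ b = 0" for a b
  proof -
    let ?E = "outer (axis a 1) (axis b 1) :: real^'n^'m"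
    have up: "(\<lambda>i. stat_measure f q (W i) * norm ?E) \<longlonglongrightarrow> 0"
      using tendsto_mult_right[OF s, of "norm ?E"] by simp
    have "- ?E = outer (- axis a 1) (axis b 1)"
      using outer_scaleR_left[of "-1" "axis a 1 :: real^'m" "axis b 1 :: real^'n"] by simp
    then have "- ?E \<in> tangent_cone (rank_le q) (W i)" for i
      using outer_tangent_of_deficient_rank[OF W] by metis
    then have "norm (grad f (W i) \<bullet> ?E) \<le> stat_measure f q (W i) * norm ?E" for i
      unfolding real_norm_def using W[of i]
      by (intro stat_measure_bound outer_tangent_of_deficient_rank) (auto simp: rank_le_def)
    then have "(\<lambda>i. grad f (W i) \<bullet> ?E) \<longlonglongrightarrow> 0"
      by (intro Lim_null_comparison[OF always_eventually up]) auto
    moreover have "(\<lambda>i. grad f (W i) \<bullet> ?E) \<longlonglongrightarrow> grad f Z \<bullet> ?E"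
      by (intro tendsto_intros cont)
    ultimately have "grad f Z \<bullet> ?E = 0"
      using LIMSEQ_unique by blast
    then show ?thesis
      by (simp add: inner_outer inner_axis' matrix_vector_mult_basis column_def)
  qed
  then show ?thesis
    by (simp add: vec_eq_iff)
qed

section \<open>Sufficient decrease along the search direction\<close>

text \<open>The representing vector of the derivative is its adjoint applied to \<open>1\<close>.\<close>

lemma grad_GDERIV:
  fixes f :: "'a::euclidean_space \<Rightarrow> real"
  assumes "f differentiable_on UNIV"
  shows "GDERIV f x :> grad f x"
proof -
  obtain f' where f': "(f has_derivative f') (at x)"
    using assms by (auto simp: differentiable_on_def differentiable_def)
  have "h \<bullet> adjoint f' 1 = f' h" for h
    using adjoint_works[OF has_derivative_linear[OF f'], of h 1] by simp
  then have D: "GDERIV f x :> adjoint f' 1"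
    using f' by (simp add: gderiv_def)
  show ?thesis
    unfolding grad_def
  proof (rule theI[where P = "\<lambda>D. GDERIV f x :> D", OF D])
    fix E assume "GDERIV f x :> E"
    then have "(\<lambda>h. h \<bullet> E) = (\<lambda>h. h \<bullet> adjoint f' 1)"
      using D unfolding gderiv_def by (rule has_derivative_unique)
    then show "E = adjoint f' 1"
      by (metis vector_eq_ldot)
  qed
qed

lemma continuous_grad:
  assumes "locally_lipschitz_grad f"
  shows "isCont (grad f) x"
proof -
  obtain L where "L-lipschitz_on (cball x 1) (grad f)"
    using assms by (auto simp: locally_lipschitz_grad_def)
  then have "continuous_on (cball x 1) (grad f)"
    by (rule lipschitz_on_continuous_on)
  then have "continuous_on (ball x 1) (grad f)"
    by (rule continuous_on_subset) auto
  then show ?thesis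
    by (simp add: continuous_on_eq_continuous_at)
qed

text \<open>The mean value theorem evaluates the gradient at one intermediate point; this yields the constant
  \<open>L\<close>, where integration along the segment would yield \<open>L / 2\<close>.\<close>

lemma lipschitz_grad_upper_bound:
  fixes f :: "'a::euclidean_space \<Rightarrow> real"
  assumes diff: "f differentiable_on UNIV" and lip: "L-lipschitz_on S (grad f)"
    and S: "convex S" "x \<in> S" "x + d \<in> S"
  shows "f (x + d) \<le> f x + grad f x \<bullet> d + L * (norm d)\<^sup>2"
proof -
  define \<phi> where "\<phi> t = f (x + t *\<^sub>R d)" for t
  have "DERIV \<phi> t :> d \<bullet> grad f (x + t *\<^sub>R d)" for t
  proof -
    have "((\<lambda>t. x + t *\<^sub>R d) has_derivative (\<lambda>h. h *\<^sub>R d)) (at t)"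
      by (auto intro!: derivative_eq_intros)
    moreover have "(f has_derivative (\<lambda>h. h \<bullet> grad f (x + t *\<^sub>R d))) (at (x + t *\<^sub>R d))"
      using grad_GDERIV[OF diff] by (simp add: gderiv_def)
    ultimately have "(\<phi> has_derivative (\<lambda>h. (h *\<^sub>R d) \<bullet> grad f (x + t *\<^sub>R d))) (at t)"
      unfolding \<phi>_def by (rule has_derivative_compose)
    then show ?thesis
      by (simp add: has_field_derivative_def mult.commute[of _ "d \<bullet> _"])
  qed
  then obtain t where t: "0 < t" "t < 1" "\<phi> 1 - \<phi> 0 = (1 - 0) * (d \<bullet> grad f (x + t *\<^sub>R d))"
    using MVT2[of 0 1 \<phi> "\<lambda>t. d \<bullet> grad f (x + t *\<^sub>R d)"] by auto
  have "x + t *\<^sub>R d = (1 - t) *\<^sub>R x + t *\<^sub>R (x + d)"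
    by (simp add: algebra_simps)
  then have inS: "x + t *\<^sub>R d \<in> S"
    using S t convexD[OF S(1,2,3), of "1 - t" t] by simp
  have "d \<bullet> (grad f (x + t *\<^sub>R d) - grad f x) \<le> norm d * norm (grad f (x + t *\<^sub>R d) - grad f x)"
    by (rule norm_cauchy_schwarz)
  also have "\<dots> \<le> norm d * (L * norm (t *\<^sub>R d))"
    using lipschitz_onD[OF lip inS S(2)] by (intro mult_left_mono) (simp_all add: dist_norm)
  also have "\<dots> \<le> norm d * (L * norm d)"
    using t lipschitz_on_nonneg[OF lip] by (intro mult_left_mono) (auto simp: mult_left_le_one_le)
  finally show ?thesis
    using t(3) by (simp add: \<phi>_def inner_diff_right inner_commute power2_eq_square mult_ac)
qed

text \<open>For \<open>X\<close> in a fixed ball, the angle condition bounds \<open>norm G\<close>, so all trial points lie in a larger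
  ball and one Lipschitz constant \<open>L\<close> serves all of them. The sufficient-decrease test then succeeds for every step
  up to \<open>\<kappa>\<^sub>2 (1 - c) / L\<close>, so the accepted step is at least the smaller of \<open>a\<close> and \<open>\<beta>\<close> times
  this threshold. Hence the decrease is a fixed multiple of the squared stationarity measure, even
  if \<open>X\<close> approaches points where that measure is discontinuous.\<close>

lemma ERFD_sufficient_decrease:
  fixes f :: "real^'n^'m \<Rightarrow> real"
  assumes diff: "f differentiable_on UNIV" and lip: "locally_lipschitz_grad f"
    and a: "0 < a" and \<beta>: "\<beta> \<in> {0<..<1}" and c: "c \<in> {0<..<1}" and \<kappa>\<^sub>1: "0 < \<kappa>\<^sub>1" and \<kappa>\<^sub>2: "0 < \<kappa>\<^sub>2"
  obtains \<eta> where "0 < \<eta>"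
    "\<And>q X Y. norm X \<le> \<rho> \<Longrightarrow> Y \<in> ERFD f q a b \<beta> c \<kappa>\<^sub>1 \<kappa>\<^sub>2 X \<Longrightarrow>
       f Y \<le> f X - \<eta> * (stat_measure f q X)\<^sup>2"
proof -
  obtain L\<^sub>0 where L0: "L\<^sub>0-lipschitz_on (cball 0 \<bar>\<rho>\<bar>) (grad f)"
    using lip by (auto simp: locally_lipschitz_grad_def)
  define M where "M = norm (grad f 0) + L\<^sub>0 * \<bar>\<rho>\<bar>"
  have M: "norm (grad f X) \<le> M" if "norm X \<le> \<rho>" for X
  proof -
    have "norm (grad f X - grad f 0) \<le> L\<^sub>0 * norm X"
      using lipschitz_onD[OF L0, of X 0] that by (simp add: dist_norm)
    also have "\<dots> \<le> L\<^sub>0 * \<bar>\<rho>\<bar>"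
      using that lipschitz_on_nonneg[OF L0] by (intro mult_left_mono) auto
    finally show ?thesis
      using norm_triangle_sub[of "grad f X" "grad f 0"] by (simp add: M_def)
  qed
  define R where "R = \<bar>\<rho>\<bar> + b * (M / \<kappa>\<^sub>2)"
  obtain L\<^sub>1 where L1: "L\<^sub>1-lipschitz_on (cball 0 R) (grad f)"
    using lip by (auto simp: locally_lipschitz_grad_def)
  define L where "L = L\<^sub>1 + 1"
  have "L-lipschitz_on (cball 0 R) (grad f)"
    by (rule lipschitz_on_mono[OF L1]) (auto simp: L_def)
  have L: "0 < L"
    using lipschitz_on_nonneg[OF L1] by (simp add: L_def)
  define \<alpha>min where "\<alpha>min = min a (\<beta> * (\<kappa>\<^sub>2 * (1 - c) / L))"
  have \<alpha>min: "0 < \<alpha>min"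
    using a \<beta> c \<kappa>\<^sub>2 L by (simp add: \<alpha>min_def)
  show thesis
  proof (rule that[of "c * \<alpha>min * \<kappa>\<^sub>1"])
    show "0 < c * \<alpha>min * \<kappa>\<^sub>1"
      using c \<alpha>min \<kappa>\<^sub>1 by simp
    fix q :: nat and X Y :: "real^'n^'m"
    assume X: "norm X \<le> \<rho>" and Y: "Y \<in> ERFD f q a b \<beta> c \<kappa>\<^sub>1 \<kappa>\<^sub>2 X"
    then obtain G \<alpha>\<^sub>0 \<alpha> where YG: "Y = X + \<alpha> *\<^sub>R G"
      and G1: "\<kappa>\<^sub>1 * (stat_measure f q X)\<^sup>2 \<le> - (grad f X \<bullet> G)"
      and G2: "\<kappa>\<^sub>2 * (norm G)\<^sup>2 \<le> - (grad f X \<bullet> G)"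
      and \<alpha>0: "\<alpha>\<^sub>0 \<in> {a..b}"
      and loop: "while_option (\<lambda>\<alpha>. f (X + \<alpha> *\<^sub>R G) > f X + c * \<alpha> * (grad f X \<bullet> G))
        (\<lambda>\<alpha>. \<alpha> * \<beta>) \<alpha>\<^sub>0 = Some \<alpha>"
      by (auto simp: ERFD_def inner_commute)
    have "\<kappa>\<^sub>2 * (norm G)\<^sup>2 \<le> norm (grad f X) * norm G"
      using G2 Cauchy_Schwarz_ineq2[of "grad f X" G] by linarith
    also have "\<dots> \<le> M * norm G"
      by (intro mult_right_mono M X) simp
    finally have normG: "norm G \<le> M / \<kappa>\<^sub>2"
      using \<kappa>\<^sub>2 by (cases "G = 0") (auto simp: power2_eq_square pos_le_divide_eq mult_ac
          intro: order_trans[OF norm_ge_zero M[OF X]])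
    have "\<alpha>min \<le> \<alpha> \<and> \<alpha> \<le> b"
    proof (rule while_option_rule[OF _ loop, where P = "\<lambda>\<alpha>. \<alpha>min \<le> \<alpha> \<and> \<alpha> \<le> b"])
      show "\<alpha>min \<le> \<alpha>\<^sub>0 \<and> \<alpha>\<^sub>0 \<le> b"
        using \<alpha>0 by (auto simp: \<alpha>min_def intro: min.coboundedI1)
      fix \<gamma> assume \<gamma>: "\<alpha>min \<le> \<gamma> \<and> \<gamma> \<le> b"
        and fail: "f (X + \<gamma> *\<^sub>R G) > f X + c * \<gamma> * (grad f X \<bullet> G)"
      have \<gamma>0: "0 < \<gamma>" using \<gamma> \<alpha>min by linarith
      have "norm (\<gamma> *\<^sub>R G) \<le> b * (M / \<kappa>\<^sub>2)"
        using \<gamma> \<gamma>0 normG by (simp only: norm_scaleR) (intro mult_mono, auto)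
      then have "X + \<gamma> *\<^sub>R G \<in> cball 0 R" "X \<in> cball 0 R"
        using X norm_triangle_ineq[of X "\<gamma> *\<^sub>R G"] norm_ge_zero[of "\<gamma> *\<^sub>R G"]
        unfolding R_def mem_cball_0 by linarith+
      then have "f (X + \<gamma> *\<^sub>R G) \<le> f X + grad f X \<bullet> (\<gamma> *\<^sub>R G) + L * (norm (\<gamma> *\<^sub>R G))\<^sup>2"
        by (intro lipschitz_grad_upper_bound[OF diff \<open>L-lipschitz_on (cball 0 R) (grad f)\<close>]) auto
      then have "\<gamma> * (c * (grad f X \<bullet> G)) < \<gamma> * ((grad f X \<bullet> G) + L * \<gamma> * (norm G)\<^sup>2)"
        using fail by (simp add: power_mult_distrib power2_eq_square algebra_simps)
      then have "c * (grad f X \<bullet> G) < (grad f X \<bullet> G) + L * \<gamma> * (norm G)\<^sup>2"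
        by (rule mult_left_less_imp_less) (use \<gamma>0 in simp)
      then have "(1 - c) * (- (grad f X \<bullet> G)) < L * \<gamma> * (norm G)\<^sup>2"
        by (simp add: algebra_simps)
      moreover have "(1 - c) * (\<kappa>\<^sub>2 * (norm G)\<^sup>2) \<le> (1 - c) * (- (grad f X \<bullet> G))"
        using c by (intro mult_left_mono G2) auto
      ultimately have "((1 - c) * \<kappa>\<^sub>2) * (norm G)\<^sup>2 < (L * \<gamma>) * (norm G)\<^sup>2"
        by simp
      then have "(1 - c) * \<kappa>\<^sub>2 < L * \<gamma>"
        by (rule mult_right_less_imp_less) simp
      then have "\<kappa>\<^sub>2 * (1 - c) / L \<le> \<gamma>"
        using L by (simp add: pos_divide_le_eq mult.commute)
      then have "\<beta> * (\<kappa>\<^sub>2 * (1 - c) / L) \<le> \<beta> * \<gamma>"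
        using \<beta> by (intro mult_left_mono) auto
      moreover have "\<beta> * \<gamma> \<le> \<gamma>"
        using \<beta> \<gamma>0 by (simp add: mult_left_le_one_le)
      ultimately show "\<alpha>min \<le> \<gamma> * \<beta> \<and> \<gamma> * \<beta> \<le> b"
        using \<gamma> by (simp add: \<alpha>min_def mult.commute)
    qed
    then have "\<alpha>min * (\<kappa>\<^sub>1 * (stat_measure f q X)\<^sup>2) \<le> \<alpha> * (- (grad f X \<bullet> G))"
      using \<alpha>min \<kappa>\<^sub>1 G1 by (intro mult_mono) auto
    then have "c * (\<alpha>min * (\<kappa>\<^sub>1 * (stat_measure f q X)\<^sup>2)) \<le> c * (\<alpha> * (- (grad f X \<bullet> G)))"
      using c by (intro mult_left_mono) auto
    moreover have "f Y \<le> f X + c * \<alpha> * (grad f X \<bullet> G)"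
      using while_option_stop[OF loop] YG by simp
    ultimately show "f Y \<le> f X - c * \<alpha>min * \<kappa>\<^sub>1 * (stat_measure f q X)\<^sup>2"
      by (simp add: mult.assoc)
  qed
qed

section \<open>Iterations with rank reduction\<close>

lemma ERFDR_le_ERFD:
  assumes "Y \<in> ERFDR f q a b \<beta> c \<kappa>\<^sub>1 \<kappa>\<^sub>2 \<Delta> X"
  obtains X' where "X' \<in> ERFD f q a b \<beta> c \<kappa>\<^sub>1 \<kappa>\<^sub>2 X" "f Y \<le> f X'"
  using assms by (auto simp: ERFDR_def is_arg_min_linorder split: if_splits)

lemma ERFDR_le_reduced:
  assumes "Y \<in> ERFDR f q a b \<beta> c \<kappa>\<^sub>1 \<kappa>\<^sub>2 \<Delta> X" "singular_value q X \<in> {0<..\<Delta>}"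
  obtains Xh XR where "Xh \<in> proj_set (rank_eq (q - 1)) X"
    "XR \<in> ERFD f q a b \<beta> c \<kappa>\<^sub>1 \<kappa>\<^sub>2 Xh" "f Y \<le> f XR"
  using assms by (auto simp: ERFDR_def is_arg_min_linorder)

lemma ERFDR_step_nonincreasing:
  fixes f :: "real^'n^'m \<Rightarrow> real"
  assumes "f differentiable_on UNIV" "locally_lipschitz_grad f"
    "0 < a" "\<beta> \<in> {0<..<1}" "c \<in> {0<..<1}" "0 < \<kappa>\<^sub>1" "0 < \<kappa>\<^sub>2"
    and step: "ERFDR_step f q a b \<beta> c \<kappa>\<^sub>1 \<kappa>\<^sub>2 \<Delta> X Y"
  shows "f Y \<le> f X"
proof -
  obtain \<Delta>' where "Y \<in> ERFDR f q a b \<beta> c \<kappa>\<^sub>1 \<kappa>\<^sub>2 \<Delta>' X"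
    using step by (auto simp: ERFDR_step_def)
  then obtain X' where X': "X' \<in> ERFD f q a b \<beta> c \<kappa>\<^sub>1 \<kappa>\<^sub>2 X" "f Y \<le> f X'"
    by (rule ERFDR_le_ERFD)
  obtain \<eta> where "0 < \<eta>" "f X' \<le> f X - \<eta> * (stat_measure f q X)\<^sup>2"
    using ERFD_sufficient_decrease[OF assms(1-7), of "norm X" b] X'(1) by (metis order_refl)
  then show ?thesis
    using X'(2) by (smt (verit) mult_nonneg_nonneg zero_le_power2)
qed

lemma ERFDR_steps_nonincreasing:
  fixes f :: "real^'n^'m \<Rightarrow> real"
  assumes "f differentiable_on UNIV" "locally_lipschitz_grad f"
    "0 < a" "\<beta> \<in> {0<..<1}" "c \<in> {0<..<1}" "0 < \<kappa>\<^sub>1" "0 < \<kappa>\<^sub>2"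
    and steps: "(ERFDR_step f q a b \<beta> c \<kappa>\<^sub>1 \<kappa>\<^sub>2 \<Delta>)\<^sup>*\<^sup>* X Y"
  shows "f Y \<le> f X"
  using steps
  by (induction rule: rtranclp_induct)
    (auto dest: ERFDR_step_nonincreasing[OF assms(1-7)] intro: order_trans)

text \<open>The distance from \<open>X\<close> to the matrices of rank one less is at most its smallest nonzero singular
  value, hence at most its distance to any matrix of smaller rank.\<close>

lemma dist_proj_rank_minus_one:
  fixes X Xh Z :: "real^'n^'m"
  assumes "Xh \<in> proj_set (rank_eq (rank X - 1)) X" and Z: "rank Z < rank X"
  shows "rank Xh = rank X - 1" "dist X Xh \<le> dist X Z"
proof -
  have q: "0 < rank X" "rank X \<in> {1..min CARD('m) CARD('n)}"
    using Z rank_bound[of X] by auto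
  obtain W where W: "rank W = rank X - 1" "norm (X - W) \<le> singular_value (rank X) X"
    using approx_of_rank_minus_one[OF q(1)] .
  show "rank Xh = rank X - 1"
    using assms(1) by (simp add: proj_set_def is_arg_min_linorder rank_eq_def)
  have "dist X Xh \<le> dist X W"
    using assms(1) W(1) by (simp add: proj_set_def is_arg_min_linorder rank_eq_def)
  also have "\<dots> \<le> dist X Z"
    using W(2) singular_value_le_norm_diff[OF q(2) Z, of X] by (simp add: dist_norm)
  finally show "dist X Xh \<le> dist X Z" .
qed

text \<open>The interesting case is a limit \<open>Z\<close> of rank less than \<open>q\<close>. Each \<open>W\<^sub>i\<close> is replaced by a matrix
  \<open>U\<^sub>i\<close> of rank less than \<open>q\<close> that converges to \<open>Z\<close> as well: \<open>W\<^sub>i\<close> itself if its rank is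
  deficient, and otherwise the rank reduction performed by the step, which takes place because
  the \<open>q\<close>-th singular value of \<open>W\<^sub>i\<close> tends to \<open>0\<close> and so falls below \<open>\<Delta>\<close>. In the second case the step descends from
  \<open>U\<^sub>i\<close> to a value that is still at least \<open>f Z\<close>, so sufficient decrease bounds the squared measure at
  \<open>U\<^sub>i\<close> by a multiple of \<open>f U\<^sub>i - f Z\<close>, which tends to \<open>0\<close>. With the measure vanishing along
  matrices of deficient rank, the gradient vanishes at \<open>Z\<close>.\<close>

lemma b_stationary_limit_of_ERFDR_steps:
  fixes f :: "real^'n^'m \<Rightarrow> real"
  assumes diff: "f differentiable_on UNIV" and lip: "locally_lipschitz_grad f"
    and params: "0 < a" "\<beta> \<in> {0<..<1}" "c \<in> {0<..<1}" "0 < \<kappa>\<^sub>1" "0 < \<kappa>\<^sub>2" and \<Delta>: "0 < \<Delta>"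
    and q: "0 < q" "q \<le> min CARD('m) CARD('n)"
    and W: "\<And>i. W i \<in> rank_le q" "W \<longlonglongrightarrow> Z"
    and s: "(\<lambda>i. stat_measure f q (W i)) \<longlonglongrightarrow> 0"
    and step: "\<And>i. ERFDR_step f q a b \<beta> c \<kappa>\<^sub>1 \<kappa>\<^sub>2 \<Delta> (W i) (V i)"
    and V: "\<And>i. f Z \<le> f (V i)"
  shows "b_stationary f q Z"
proof (cases "rank Z = q")
  case True
  have "(\<lambda>i. grad f (W i)) \<longlonglongrightarrow> grad f Z"
    by (rule isCont_tendsto_compose[OF continuous_grad[OF lip] W(2)])
  then show ?thesis
    using b_stationary_limit_full_rank[OF W True q(1) _ s] by simp
next
  case False
  have "Z \<in> rank_le q"
    using closed_sequentially[OF closed_rank_le W] .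
  with False have Z: "rank Z < q" by (simp add: rank_le_def)
  obtain \<eta> where \<eta>: "0 < \<eta>" and dec: "\<And>X Y. norm X \<le> norm Z + 2 \<Longrightarrow>
      Y \<in> ERFD f q a b \<beta> c \<kappa>\<^sub>1 \<kappa>\<^sub>2 X \<Longrightarrow> f Y \<le> f X - \<eta> * (stat_measure f q X)\<^sup>2"
    using ERFD_sufficient_decrease[OF diff lip params, of "norm Z + 2" b] by metis
  have "\<forall>\<^sub>F i in sequentially. dist (W i) Z < min 1 \<Delta>"
    using \<Delta> by (intro tendstoD[OF W(2)]) auto
  then obtain N where N: "\<And>i. N \<le> i \<Longrightarrow> dist (W i) Z < 1 \<and> dist (W i) Z < \<Delta>"
    by (auto simp: eventually_sequentially)
  have "\<exists>U. rank U < q \<and> dist (W i) U \<le> dist (W i) Z \<and>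
      (stat_measure f q U)\<^sup>2 \<le> (stat_measure f q (W i))\<^sup>2 + (f U - f Z) / \<eta>" if i: "N \<le> i" for i
  proof (cases "rank (W i) < q")
    case True
    have "f Z \<le> f (W i)"
      using V ERFDR_step_nonincreasing[OF diff lip params step] by (rule order_trans)
    then show ?thesis
      using True \<eta> by (intro exI[of _ "W i"]) simp
  next
    case False
    with W(1)[of i] have rW: "rank (W i) = q" by (simp add: rank_le_def)
    have qI: "q \<in> {1..min CARD('m) CARD('n)}" using q by auto
    obtain \<Delta>' where \<Delta>': "\<Delta> \<le> \<Delta>'" "V i \<in> ERFDR f q a b \<beta> c \<kappa>\<^sub>1 \<kappa>\<^sub>2 \<Delta>' (W i)"
      using step[of i] by (auto simp: ERFDR_step_def)
    have "singular_value q (W i) \<le> dist (W i) Z"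
      using singular_value_le_norm_diff[OF qI Z] by (simp add: dist_norm)
    then have "singular_value q (W i) \<in> {0<..\<Delta>'}"
      using singular_value_pos[OF qI, of "W i"] rW N[OF i] \<Delta>'(1) by simp
    then obtain Xh XR where Xh: "Xh \<in> proj_set (rank_eq (q - 1)) (W i)"
      and XR: "XR \<in> ERFD f q a b \<beta> c \<kappa>\<^sub>1 \<kappa>\<^sub>2 Xh" "f (V i) \<le> f XR"
      by (rule ERFDR_le_reduced[OF \<Delta>'(2)])
    have rXh: "rank Xh = q - 1" and dXh: "dist (W i) Xh \<le> dist (W i) Z"
      using dist_proj_rank_minus_one[of Xh "W i" Z] Xh Z rW by simp_all
    have "dist Xh Z \<le> 2"
      using dist_triangle3[of Xh Z "W i"] dXh N[OF i] by linarith
    then have "norm Xh \<le> norm Z + 2"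
      using norm_triangle_sub[of Xh Z] by (simp add: dist_norm)
    then have "\<eta> * (stat_measure f q Xh)\<^sup>2 \<le> f Xh - f Z"
      using dec[OF _ XR(1)] XR(2) V[of i] by linarith
    then have "(stat_measure f q Xh)\<^sup>2 \<le> (f Xh - f Z) / \<eta>"
      using \<eta> by (simp add: pos_le_divide_eq mult.commute)
    then show ?thesis
      using rXh dXh q(1) by (intro exI[of _ Xh]) (simp add: add_increasing)
  qed
  then obtain U where U: "\<And>i. N \<le> i \<Longrightarrow> rank (U i) < q"
    "\<And>i. N \<le> i \<Longrightarrow> dist (W i) (U i) \<le> dist (W i) Z"
    "\<And>i. N \<le> i \<Longrightarrow> (stat_measure f q (U i))\<^sup>2 \<le> (stat_measure f q (W i))\<^sup>2 + (f (U i) - f Z) / \<eta>"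
    by metis
  define W' where "W' i = W (i + N)" for i
  define U' where "U' i = U (i + N)" for i
  have W'lim: "W' \<longlonglongrightarrow> Z" "(\<lambda>i. stat_measure f q (W' i)) \<longlonglongrightarrow> 0"
    unfolding W'_def by (rule LIMSEQ_ignore_initial_segment[OF W(2)], rule LIMSEQ_ignore_initial_segment[OF s])
  have "(\<lambda>i. 2 * dist (W' i) Z) \<longlonglongrightarrow> 2 * 0"
    using tendsto_dist_iff[THEN iffD1, OF W'lim(1)] by (rule tendsto_mult_left)
  then have up: "(\<lambda>i. 2 * dist (W' i) Z) \<longlonglongrightarrow> 0"
    by simp
  have "\<forall>i. norm (dist (U' i) Z) \<le> 2 * dist (W' i) Z"
  proof
    fix i
    show "norm (dist (U' i) Z) \<le> 2 * dist (W' i) Z"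
      using U(2)[of "i + N"] dist_triangle3[of "U' i" Z "W' i"] by (simp add: W'_def U'_def)
  qed
  from Lim_null_comparison[OF always_eventually[OF this] up] have Ulim: "U' \<longlonglongrightarrow> Z"
    by (rule tendsto_dist_iff[THEN iffD2])
  have "isCont f Z"
    using differentiable_imp_continuous_on[OF diff] by (simp add: continuous_on_eq_continuous_at)
  then have "(\<lambda>i. f (U' i)) \<longlonglongrightarrow> f Z"
    by (rule isCont_tendsto_compose[OF _ Ulim])
  then have "(\<lambda>i. (stat_measure f q (W' i))\<^sup>2 + (f (U' i) - f Z) / \<eta>) \<longlonglongrightarrow> 0\<^sup>2 + (f Z - f Z) / \<eta>"
    using \<eta> by (intro tendsto_intros W'lim) auto
  then have up': "(\<lambda>i. (stat_measure f q (W' i))\<^sup>2 + (f (U' i) - f Z) / \<eta>) \<longlonglongrightarrow> 0"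
    by simp
  have "(\<lambda>i. (stat_measure f q (U' i))\<^sup>2) \<longlonglongrightarrow> 0"
    by (rule Lim_null_comparison[OF always_eventually up']) (use U(3) in \<open>auto simp: W'_def U'_def\<close>)
  then have "(\<lambda>i. stat_measure f q (U' i)) \<longlonglongrightarrow> 0"
    by (simp add: power_tendsto_0_iff)
  moreover have "(\<lambda>i. grad f (U' i)) \<longlonglongrightarrow> grad f Z"
    by (rule isCont_tendsto_compose[OF continuous_grad[OF lip] Ulim])
  ultimately have "grad f Z = 0"
    using grad_eq_0_limit_deficient_rank[of U' q f Z] U(1) by (simp add: U'_def)
  then show ?thesis
    using \<open>Z \<in> rank_le q\<close> by (simp add: b_stationary_def)
qed

section \<open>The rank-increasing algorithm\<close>

lemma bounded_mono_nat_eventually_const: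
  fixes k :: "nat \<Rightarrow> nat"
  assumes "mono k" "\<And>i. k i \<le> r"
  obtains N q where "\<And>i. N \<le> i \<Longrightarrow> k i = q"
proof -
  have fin: "finite (range k)"
    by (rule finite_subset[of _ "{..r}"]) (use assms(2) in auto)
  then have "Max (range k) \<in> range k"
    by (intro Max_in) auto
  then obtain N where N: "k N = Max (range k)" by auto
  have "k i = k N" if "N \<le> i" for i
    using monoD[OF assms(1) that] N Max_ge[OF fin, of "k i"] by simp
  then show thesis
    using that by blast
qed

theorem corollary5p1:
  fixes f :: "real^'n^'m \<Rightarrow> real"
    and r r\<^sub>0 :: nat
    and \<alpha>lo \<alpha>hi \<beta> c \<tau> \<kappa>\<^sub>1 \<kappa>\<^sub>2 \<Delta> \<epsilon> :: real
    and X\<^sub>0 :: "real^'n^'m"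
    and X :: "nat \<Rightarrow> real^'n^'m"
    and rs :: "nat \<Rightarrow> nat"
    and istar :: enat
  assumes "0 < r" and "r < min CARD('m) CARD('n)"
    and "f differentiable_on UNIV" and "locally_lipschitz_grad f"
    and "0 < \<alpha>lo" and "\<alpha>lo \<le> \<alpha>hi"
    and "\<beta> \<in> {0<..<1}" and "c \<in> {0<..<1}" and "\<tau> \<in> {0<..<1}"
    and "\<kappa>\<^sub>1 \<in> {0<..1/2}" and "\<kappa>\<^sub>2 \<in> {0<..1}"
    and "0 < \<Delta>" and "0 < \<epsilon>"
    and "r\<^sub>0 \<in> {1..r}" and "X\<^sub>0 \<in> rank_le r\<^sub>0"
    and "bounded {Y \<in> rank_le r. f Y \<le> f X\<^sub>0}"
    and "rank_increasing_ERFDR_run f r \<alpha>lo \<alpha>hi \<beta> c \<kappa>\<^sub>1 \<kappa>\<^sub>2 \<Delta> \<tau> \<epsilon> X\<^sub>0 r\<^sub>0 X rs istar"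
  shows "(\<forall>N. istar = enat N \<longrightarrow>
            b_stationary f (rs N) (X N) \<and> stat_measure f (rs N) (X N) = 0) \<and>
         (istar = \<infinity> \<longrightarrow>
            (\<exists>rlim. rs \<longlonglongrightarrow> rlim \<and>
               (\<exists>Z. accumulation_point X Z) \<and>
               (\<forall>Z. accumulation_point X Z \<longrightarrow>
                  b_stationary f rlim Z \<and> stat_measure f rlim Z = 0) \<and>
               (\<lambda>i. stat_measure f rlim (X i)) \<longlonglongrightarrow> 0 \<and>
               (\<forall>Z Z'. accumulation_point X Z \<and> accumulation_point X Z' \<longrightarrow> f Z = f Z')))"
proof (intro conjI allI impI)
  note diff = assms(3) and lip = assms(4)
  have params: "0 < \<alpha>lo" "\<beta> \<in> {0<..<1}" "c \<in> {0<..<1}" "0 < \<kappa>\<^sub>1" "0 < \<kappa>\<^sub>2"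
    using assms by auto
  let ?step = "\<lambda>q. ERFDR_step f q \<alpha>lo \<alpha>hi \<beta> c \<kappa>\<^sub>1 \<kappa>\<^sub>2 \<Delta>"
  have init: "X 0 = X\<^sub>0" "rs 0 = r\<^sub>0"
    and run: "\<And>i. enat i < istar \<Longrightarrow> (?step (rs i))\<^sup>+\<^sup>+ (X i) (X (Suc i)) \<and>
        X (Suc i) \<in> rank_le (rs i) \<and> stat_measure f (rs i) (X (Suc i)) \<le> \<tau> ^ i * \<epsilon> \<and>
        rs (Suc i) \<in> {rs i..r}"
    and final: "\<And>i. istar = enat i \<Longrightarrow> \<not> stat_measure f (rs i) (X i) > 0"
    using assms(17) by (auto simp: rank_increasing_ERFDR_run_def)
  have rank_X: "X i \<in> rank_le (rs i)" if "enat i \<le> istar" for i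
  proof (cases i)
    case 0
    then show ?thesis using init assms(15) by simp
  next
    case (Suc j)
    then have "X i \<in> rank_le (rs j)" "rs j \<le> rs i"
      using run[of j] that by (auto simp: Suc_ile_eq)
    then show ?thesis by (simp add: rank_le_def)
  qed
  {
    fix N assume N: "istar = enat N"
    then have XN: "X N \<in> rank_le (rs N)" by (intro rank_X) simp
    show "stat_measure f (rs N) (X N) = 0"
      using final[OF N] stat_measure_nonneg[OF XN, of f] by linarith
    then show "b_stationary f (rs N) (X N)"
      by (simp add: b_stationary_iff[OF XN])
  next
    assume inf: "istar = \<infinity>"
    have steps: "(?step (rs i))\<^sup>+\<^sup>+ (X i) (X (Suc i))"
      and small: "stat_measure f (rs i) (X (Suc i)) \<le> \<tau> ^ i * \<epsilon>"
      and rs_Suc: "rs i \<le> rs (Suc i)" "rs (Suc i) \<le> r" for i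
      using run[of i] inf by auto
    have XR: "X i \<in> rank_le (rs i)" for i
      using rank_X inf by simp
    have rs_le: "rs i \<le> r" for i
      using rs_Suc(2) init assms(14) by (cases i) auto
    have rs_mono: "mono rs"
      using rs_Suc(1) by (simp add: mono_iff_le_Suc)
    obtain n\<^sub>0 q where rs_q: "\<And>i. n\<^sub>0 \<le> i \<Longrightarrow> rs i = q"
      using bounded_mono_nat_eventually_const[OF rs_mono rs_le] by blast
    have q: "0 < q" "q \<le> r"
      using rs_q[of n\<^sub>0] monoD[OF rs_mono, of 0 n\<^sub>0] rs_le[of n\<^sub>0] init assms(14) by auto
    have rs_lim: "rs \<longlonglongrightarrow> q"
      by (rule tendsto_eventually) (use rs_q in \<open>auto simp: eventually_sequentially\<close>)
    have f_dec: "decseq (\<lambda>i. f (X i))"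
      unfolding decseq_Suc_iff
      using ERFDR_steps_nonincreasing[OF diff lip params tranclp_into_rtranclp[OF steps]] by blast
    have isCont: "isCont f Z" for Z
      using differentiable_imp_continuous_on[OF diff] by (simp add: continuous_on_eq_continuous_at)
    have stat_lim: "(\<lambda>i. stat_measure f q (X i)) \<longlonglongrightarrow> 0"
    proof -
      have "(\<lambda>i. \<tau> ^ i * \<epsilon>) \<longlonglongrightarrow> 0 * \<epsilon>"
        using assms(9) by (intro tendsto_intros LIMSEQ_power_zero) auto
      then have up: "(\<lambda>i. \<tau> ^ i * \<epsilon>) \<longlonglongrightarrow> 0" by simp
      have "norm (stat_measure f q (X (Suc i))) \<le> \<tau> ^ i * \<epsilon>" if "n\<^sub>0 \<le> i" for i
        using small[of i] rs_q[of i] rs_q[of "Suc i"] that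
          stat_measure_nonneg[OF XR[of "Suc i"], of f] by simp
      then have "(\<lambda>i. stat_measure f q (X (Suc i))) \<longlonglongrightarrow> 0"
        by (intro Lim_null_comparison[OF _ up]) (auto simp: eventually_sequentially)
      then show ?thesis
        by (rule LIMSEQ_imp_Suc)
    qed
    have f_lim: "(\<lambda>i. f (X i)) \<longlonglongrightarrow> f Z" if Z: "accumulation_point X Z" for Z
    proof -
      obtain \<phi> where \<phi>: "strict_mono \<phi>" "(X \<circ> \<phi>) \<longlonglongrightarrow> Z"
        using Z by (auto simp: accumulation_point_def)
      have sub: "(\<lambda>i. f (X (\<phi> i))) \<longlonglongrightarrow> f Z"
        using isCont_tendsto_compose[OF isCont \<phi>(2)] by (simp add: o_def)
      have "f Z \<le> f (X i)" for i
      proof (rule LIMSEQ_le_const2[OF sub], intro exI allI impI)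
        fix k assume "i \<le> k"
        then have "i \<le> \<phi> k"
          using seq_suble[OF \<phi>(1), of k] by linarith
        then show "f (X (\<phi> k)) \<le> f (X i)"
          by (rule decseqD[OF f_dec])
      qed
      then obtain l where l: "(\<lambda>i. f (X i)) \<longlonglongrightarrow> l"
        using decseq_convergent[OF f_dec] by metis
      then have "(\<lambda>i. f (X (\<phi> i))) \<longlonglongrightarrow> l"
        using LIMSEQ_subseq_LIMSEQ[OF l \<phi>(1)] by (simp add: o_def)
      then show ?thesis
        using l sub LIMSEQ_unique by blast
    qed
    have exists: "\<exists>Z. accumulation_point X Z"
    proof -
      have "range X \<subseteq> {Y \<in> rank_le r. f Y \<le> f X\<^sub>0}"
      proof clarify
        fix i
        have "rank (X i) \<le> r"
          using XR[of i] rs_le[of i] by (simp add: rank_le_def)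
        then show "X i \<in> rank_le r \<and> f (X i) \<le> f X\<^sub>0"
          using decseqD[OF f_dec, of 0 i] init by (simp add: rank_le_def)
      qed
      then have "bounded (range X)"
        using assms(16) bounded_subset by blast
      then show ?thesis
        using bounded_imp_convergent_subsequence unfolding accumulation_point_def by blast
    qed
    have stationary: "b_stationary f q Z" if Z: "accumulation_point X Z" for Z
    proof -
      obtain \<phi> where \<phi>: "strict_mono \<phi>" "(X \<circ> \<phi>) \<longlonglongrightarrow> Z"
        using Z by (auto simp: accumulation_point_def)
      define \<psi> where "\<psi> i = \<phi> (i + n\<^sub>0)" for i
      have \<psi>: "strict_mono \<psi>" "(\<lambda>i. X (\<psi> i)) \<longlonglongrightarrow> Z"
        using \<phi>(1) LIMSEQ_ignore_initial_segment[OF \<phi>(2), of n\<^sub>0]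
        by (simp_all add: \<psi>_def strict_mono_def o_def)
      have rs\<psi>: "rs (\<psi> i) = q" for i
        using seq_suble[OF \<phi>(1), of "i + n\<^sub>0"] by (intro rs_q) (simp add: \<psi>_def)
      \<comment> \<open>\<open>V\<close> is the result of the first inner iteration; the later ones only decrease \<open>f\<close> further.\<close>
      have "\<exists>V. ?step q (X (\<psi> i)) V \<and> f (X (Suc (\<psi> i))) \<le> f V" for i
      proof -
        obtain V where "?step q (X (\<psi> i)) V" "(?step q)\<^sup>*\<^sup>* V (X (Suc (\<psi> i)))"
          using tranclpD[OF steps[of "\<psi> i"]] rs\<psi> by auto
        then show ?thesis
          using ERFDR_steps_nonincreasing[OF diff lip params] by blast
      qed
      then obtain V where V: "\<And>i. ?step q (X (\<psi> i)) (V i)" "\<And>i. f (X (Suc (\<psi> i))) \<le> f (V i)"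
        by metis
      have "f Z \<le> f (X i)" for i
        using decseq_ge[OF f_dec f_lim[OF Z]] .
      then have fV: "f Z \<le> f (V i)" for i
        using V(2) order_trans by blast
      have sub: "X (\<psi> i) \<in> rank_le q" for i
        using XR[of "\<psi> i"] rs\<psi> by simp
      have s\<psi>: "(\<lambda>i. stat_measure f q (X (\<psi> i))) \<longlonglongrightarrow> 0"
        using LIMSEQ_subseq_LIMSEQ[OF stat_lim \<psi>(1)] by (simp add: o_def)
      show ?thesis
        using q assms(2)
        by (intro b_stationary_limit_of_ERFDR_steps[OF diff lip params assms(12) _ _ sub \<psi>(2) s\<psi> V(1) fV]) auto
    qed
    show "\<exists>rlim. rs \<longlonglongrightarrow> rlim \<and> (\<exists>Z. accumulation_point X Z) \<and>
        (\<forall>Z. accumulation_point X Z \<longrightarrow> b_stationary f rlim Z \<and> stat_measure f rlim Z = 0) \<and>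
        (\<lambda>i. stat_measure f rlim (X i)) \<longlonglongrightarrow> 0 \<and>
        (\<forall>Z Z'. accumulation_point X Z \<and> accumulation_point X Z' \<longrightarrow> f Z = f Z')"
    proof (intro exI[of _ q] conjI allI impI)
      fix Z assume Z: "accumulation_point X Z"
      show st: "b_stationary f q Z"
        by (rule stationary[OF Z])
      then show "stat_measure f q Z = 0"
        using b_stationary_iff by (auto simp: b_stationary_def)
    next
      fix Z Z' assume "accumulation_point X Z \<and> accumulation_point X Z'"
      then show "f Z = f Z'"
        using f_lim LIMSEQ_unique by blast
    qed (fact rs_lim exists stat_lim)+
  }
qed

end
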